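(* Let $A$ be a finite-dimensional formally real Jordan algebra with unit $u$. Let $h,h'$ be horofunctions of $(A_+^\circ,d_T)$ given by $$h(x)=\max\{\log M(y/x),\log M(z/x^{-1})\},\qquad h'(x)=\max\{\log M(y'/x),\log M(z'/x^{-1})\},\quad x\in A_+^\circ,$$ where $y,z,y',z'\in A_+$, $y\bullet z=0=y'\bullet z'$, $\max\{\|y\|_u,\|z\|_u\}=1=\max\{\|y'\|_u,\|z'\|_u\}$ (terms with a zero vector omitted). Write the spectral decompositions $y=\sum_{i\in I}e^{-\alpha_i}p_i$, $z=\sum_{j\in J}e^{-\alpha_j}p_j$ (over the nonzero eigenvalues, with $p_k$ mutually orthogonal primitive idempotents), and let $p_I=\sum_{i\in I}p_i$ if $y\neq0$ and $p_J=\sum_{j\in J}p_j$ if $z\ne0$. Then $h$ and $h'$ lie in the same part if and only if $y\sim y'$ and $z\sim z'$. Moreover, in that case $$\delta(h,h')=d_H\big((y,z),(y',z')\big),$$ where $(y,z),(y',z')\in U_{p_I}(A)\oplus U_{p_J}(A)$ and $d_H$ is the Hilbert distance on the product cone $U_{p_I}(A)_+\times U_{p_J}(A)_+$; if $y$ or $z$ is $0$ the corresponding summand is omitted.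
   Context: $A$: finite-dimensional formally real Jordan algebra (commutative product $\bullet$, Jordan identity $x^2\bullet(x\bullet y)=x\bullet(x^2\bullet y)$, $x^2+y^2=0\Rightarrow x=y=0$) with unit $u$; $A_+=\{x^2\}$, $A_+^\circ$ its interior, $x\le y$ iff $y-x\in A_+$; $\|x\|_u=\max|\sigma(x)|$; $U_pv=2p\bullet(p\bullet v)-p^2\bullet v$, and $U_{p}(A)$ is a Jordan subalgebra with unit $p$ and cone $U_p(A)_+=U_p(A)\cap A_+$. For $x$ and $y\ge 0$ with $\alpha y\le x\le\beta y$ for some reals, $M(x/y)=\inf\{\beta:x\le\beta y\}$. For $x,y\in A_+$, $x\sim y$ iff there exist $0<\alpha\le\beta$ with $\alpha y\le x\le\beta y$. On a cone $C$ (here the product cone, ordered componentwise) the Hilbert distance between equivalent nonzero elements is $d_H(a,b)=\log M(a/b)+\log M(b/a)$; on the product, $M((a_1,a_2)/(b_1,b_2))=\max\{M(a_1/b_1),M(a_2/b_2)\}$. $d_T(x,y)=\max\{\log M(x/y),\log M(y/x)\}$ on $A_+^\circ$, basepoint $u$; $h_w(x)=d_T(x,w)-d_T(u,w)$; horofunctions are the limits of $h_w$ in the pointwise closure not of the form $h_w$. Detour cost $H(h,h')=\sup_W\inf\{d_T(u,x)+h'(x):h_x\in W\}$ over neighbourhoods $W$ of $h$; $\delta(h,h')=H(h,h')+H(h',h)$; $h,h'$ lie in the same part iff $\delta(h,h')<\infty$. *)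

theory Defs
  imports "HOL-Analysis.Analysis"
begin

text \<open>A finite-dimensional real vector space is modelled by a type of class euclidean_space;
  the Jordan product is an explicit bilinear map jp, with unit u.\<close>

definition formally_real_jordan :: "('a::euclidean_space \<Rightarrow> 'a \<Rightarrow> 'a) \<Rightarrow> 'a \<Rightarrow> bool" where
  "formally_real_jordan jp u \<longleftrightarrow>
     bilinear jp \<and>
     (\<forall>x y. jp x y = jp y x) \<and>
     (\<forall>x y. jp (jp x x) (jp x y) = jp x (jp (jp x x) y)) \<and>
     (\<forall>x y. jp x x + jp y y = 0 \<longrightarrow> x = 0 \<and> y = 0) \<and>
     (\<forall>x. jp u x = x)"

definition Apos :: "('a::euclidean_space \<Rightarrow> 'a \<Rightarrow> 'a) \<Rightarrow> 'a set" where
  "Apos jp = {jp x x | x. True}"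

definition Aint :: "('a::euclidean_space \<Rightarrow> 'a \<Rightarrow> 'a) \<Rightarrow> 'a set" where
  "Aint jp = interior (Apos jp)"

definition cle :: "'v::real_vector set \<Rightarrow> 'v \<Rightarrow> 'v \<Rightarrow> bool" where
  "cle C x y \<longleftrightarrow> y - x \<in> C"

definition Mc :: "'v::real_vector set \<Rightarrow> 'v \<Rightarrow> 'v \<Rightarrow> real" where
  "Mc C a b = Inf {\<beta>. cle C a (\<beta> *\<^sub>R b)}"

definition dH :: "'v::real_vector set \<Rightarrow> 'v \<Rightarrow> 'v \<Rightarrow> real" where
  "dH C a b = ln (Mc C a b) + ln (Mc C b a)"

definition jsim :: "('a::euclidean_space \<Rightarrow> 'a \<Rightarrow> 'a) \<Rightarrow> 'a \<Rightarrow> 'a \<Rightarrow> bool" where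
  "jsim jp x y \<longleftrightarrow> x \<in> Apos jp \<and> y \<in> Apos jp \<and>
     (\<exists>\<alpha> \<beta>. 0 < \<alpha> \<and> \<alpha> \<le> \<beta> \<and> cle (Apos jp) (\<alpha> *\<^sub>R y) x \<and> cle (Apos jp) x (\<beta> *\<^sub>R y))"

definition dT :: "('a::euclidean_space \<Rightarrow> 'a \<Rightarrow> 'a) \<Rightarrow> 'a \<Rightarrow> 'a \<Rightarrow> real" where
  "dT jp x y = max (ln (Mc (Apos jp) x y)) (ln (Mc (Apos jp) y x))"

definition jinv :: "('a::euclidean_space \<Rightarrow> 'a \<Rightarrow> 'a) \<Rightarrow> 'a \<Rightarrow> 'a \<Rightarrow> 'a" where
  "jinv jp u x = (THE y. jp x y = u \<and> jp (jp x x) y = x)"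

definition idem :: "('a::euclidean_space \<Rightarrow> 'a \<Rightarrow> 'a) \<Rightarrow> 'a \<Rightarrow> bool" where
  "idem jp p \<longleftrightarrow> jp p p = p"

definition primitive_idem :: "('a::euclidean_space \<Rightarrow> 'a \<Rightarrow> 'a) \<Rightarrow> 'a \<Rightarrow> bool" where
  "primitive_idem jp p \<longleftrightarrow> idem jp p \<and> p \<noteq> 0 \<and>
     \<not> (\<exists>q r. idem jp q \<and> idem jp r \<and> q \<noteq> 0 \<and> r \<noteq> 0 \<and> jp q r = 0 \<and> p = q + r)"

definition spec_decomp :: "('a::euclidean_space \<Rightarrow> 'a \<Rightarrow> 'a) \<Rightarrow> 'a \<Rightarrow> 'a \<Rightarrow> nat \<Rightarrow> (nat \<Rightarrow> real) \<Rightarrow> (nat \<Rightarrow> 'a) \<Rightarrow> bool" where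
  "spec_decomp jp u x k lam c \<longleftrightarrow>
     (\<forall>i<k. idem jp (c i) \<and> c i \<noteq> 0) \<and>
     (\<forall>i<k. \<forall>j<k. i \<noteq> j \<longrightarrow> jp (c i) (c j) = 0) \<and>
     sum c {..<k} = u \<and> inj_on lam {..<k} \<and>
     x = (\<Sum>i<k. lam i *\<^sub>R c i)"

definition jspectrum :: "('a::euclidean_space \<Rightarrow> 'a \<Rightarrow> 'a) \<Rightarrow> 'a \<Rightarrow> 'a \<Rightarrow> real set" where
  "jspectrum jp u x = {t. \<exists>k lam c. spec_decomp jp u x k lam c \<and> t \<in> lam ` {..<k}}"

definition unorm :: "('a::euclidean_space \<Rightarrow> 'a \<Rightarrow> 'a) \<Rightarrow> 'a \<Rightarrow> 'a \<Rightarrow> real" where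
  "unorm jp u x = Max (abs ` jspectrum jp u x)"

text \<open>y = sum_i exp(-alpha_i) p_i with mutually orthogonal primitive idempotents p_i, and
  pI = sum_i p_i.  (Empty family allowed: then y = 0 and pI = 0.)\<close>
definition prim_decomp :: "('a::euclidean_space \<Rightarrow> 'a \<Rightarrow> 'a) \<Rightarrow> 'a \<Rightarrow> 'a \<Rightarrow> bool" where
  "prim_decomp jp y pI \<longleftrightarrow> (\<exists>(n::nat) (p::nat \<Rightarrow> 'a) (\<alpha>::nat \<Rightarrow> real).
     (\<forall>i<n. primitive_idem jp (p i)) \<and>
     (\<forall>i<n. \<forall>j<n. i \<noteq> j \<longrightarrow> jp (p i) (p j) = 0) \<and>
     y = (\<Sum>i<n. exp (- \<alpha> i) *\<^sub>R p i) \<and>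
     pI = (\<Sum>i<n. p i))"

definition Uop :: "('a::euclidean_space \<Rightarrow> 'a \<Rightarrow> 'a) \<Rightarrow> 'a \<Rightarrow> 'a \<Rightarrow> 'a" where
  "Uop jp p v = 2 *\<^sub>R jp p (jp p v) - jp (jp p p) v"

definition Ucone :: "('a::euclidean_space \<Rightarrow> 'a \<Rightarrow> 'a) \<Rightarrow> 'a \<Rightarrow> 'a set" where
  "Ucone jp p = range (Uop jp p) \<inter> Apos jp"

text \<open>h_w(x) = d_T(x,w) - d_T(u,w) on the interior, extended by 0 outside (irrelevant values).\<close>
definition hw :: "('a::euclidean_space \<Rightarrow> 'a \<Rightarrow> 'a) \<Rightarrow> 'a \<Rightarrow> 'a \<Rightarrow> 'a \<Rightarrow> real" where
  "hw jp u w = (\<lambda>x. if x \<in> Aint jp then dT jp x w - dT jp u w else 0)"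

text \<open>Horofunctions: limits in the pointwise (product) topology of h_w, not of the form h_w.\<close>
definition horofunctions :: "('a::euclidean_space \<Rightarrow> 'a \<Rightarrow> 'a) \<Rightarrow> 'a \<Rightarrow> ('a \<Rightarrow> real) set" where
  "horofunctions jp u = closure (hw jp u ` Aint jp) - hw jp u ` Aint jp"

definition detour_cost :: "('a::euclidean_space \<Rightarrow> 'a \<Rightarrow> 'a) \<Rightarrow> 'a \<Rightarrow> ('a \<Rightarrow> real) \<Rightarrow> ('a \<Rightarrow> real) \<Rightarrow> ereal" where
  "detour_cost jp u h h' =
     (SUP W\<in>{W. open W \<and> h \<in> W}. INF x\<in>{x \<in> Aint jp. hw jp u x \<in> W}. ereal (dT jp u x + h' x))"

definition detour_dist :: "('a::euclidean_space \<Rightarrow> 'a \<Rightarrow> 'a) \<Rightarrow> 'a \<Rightarrow> ('a \<Rightarrow> real) \<Rightarrow> ('a \<Rightarrow> real) \<Rightarrow> ereal" where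
  "detour_dist jp u h h' = detour_cost jp u h h' + detour_cost jp u h' h"

definition horo_formula :: "('a::euclidean_space \<Rightarrow> 'a \<Rightarrow> 'a) \<Rightarrow> 'a \<Rightarrow> 'a \<Rightarrow> 'a \<Rightarrow> 'a \<Rightarrow> real" where
  "horo_formula jp u y z x =
     (if y = 0 then ln (Mc (Apos jp) z (jinv jp u x))
      else if z = 0 then ln (Mc (Apos jp) y x)
      else max (ln (Mc (Apos jp) y x)) (ln (Mc (Apos jp) z (jinv jp u x))))"

definition dH_pair :: "('a::euclidean_space \<Rightarrow> 'a \<Rightarrow> 'a) \<Rightarrow> 'a \<Rightarrow> 'a \<Rightarrow> 'a \<Rightarrow> 'a \<Rightarrow> 'a \<Rightarrow> 'a \<Rightarrow> real" where
  "dH_pair jp pI pJ y z y' z' =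
     (if y = 0 then dH (Ucone jp pJ) z z'
      else if z = 0 then dH (Ucone jp pI) y y'
      else dH (Ucone jp pI \<times> Ucone jp pJ) (y, z) (y', z'))"

end

theory Submission
  imports Defs "HOL-Computational_Algebra.Fundamental_Theorem_Algebra"
begin

text \<open>Formal reality makes the powers of an element span a product of copies of the reals, which is the
  spectral theorem; with the Peirce decomposition the trace of the multiplication operators becomes an
  associative inner product, for which the cone of squares is self-dual, and each \<open>U\<^sub>a\<close> preserves the
  cone. Positivity of \<open>U\<close> makes inversion order reversing, so \<open>d\<^sub>T(x, w) \<le> b\<close> means
  \<open>w \<le> e\<^sup>b x\<close> and \<open>w\<^sup>-\<^sup>1 \<le> e\<^sup>b x\<^sup>-\<^sup>1\<close>, just as \<open>h(x) \<le> b\<close> means \<open>y \<le> e\<^sup>b x\<close> and \<open>z \<le> e\<^sup>b x\<^sup>-\<^sup>1\<close>.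
  Along points \<open>X\<^sub>n\<close> for which \<open>e\<^sup>-\<^sup>n X\<^sub>n\<close> and \<open>e\<^sup>-\<^sup>n X\<^sub>n\<^sup>-\<^sup>1\<close> decrease to \<open>y\<close> and \<open>z\<close>, the functions
  \<open>h\<^bsub>w\<^esub>\<close> with \<open>w = X\<^sub>n\<close> converge to \<open>h\<close>, and since \<open>h'\<close> is 1-Lipschitz the detour cost is the limit of \<open>n + h'(X\<^sub>n)\<close>:
  it is at most \<open>b\<close> exactly when \<open>y' \<le> e\<^sup>b y\<close> and \<open>z' \<le> e\<^sup>b z\<close>.\<close>

section \<open>The linearized Jordan identity\<close>

text \<open>The hard point is the positivity of \<open>U\<close>. In place of the fundamental
  formula, \<open>U_factor\<close> peels one eigenvalue off \<open>a\<close> at a time, so that only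
  elements \<open>(u - c) + r c\<close> with \<open>c\<close> idempotent remain; for these,
  positivity is tested on primitive idempotents, where it is a calculation with Peirce components.
  No distance is ever computed. Each is the logarithm of an infimum and is described by its upper
  bounds \<open>b\<close>, that is, by order relations with the factor \<open>exp b\<close>; two
  quantities agree once they have the same upper bounds. In this form a term omitted because its
  vector is zero is simply a condition that always holds, so the degenerate cases merge with the
  general one. The form \<open>tf\<close> is built from traces of multiplication operators because
  the bound \<open>tf c c >= 1\<close> then holds uniformly for nonzero idempotents. This makes
  repeated splitting of an idempotent stop, and it gives an explicit ball around \<open>u\<close>
  inside the cone.\<close>

lemma eq_by_inner:
  fixes a b :: "'v::real_inner"
  assumes "\<And>i. a \<bullet> i = b \<bullet> i"
  shows "a = b"
  using assms vector_eq_rdot by blast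

locale euclidean_jordan =
  fixes jp :: "'a::euclidean_space \<Rightarrow> 'a \<Rightarrow> 'a" (infixl "\<odot>" 75) and u :: 'a
  assumes frj: "formally_real_jordan jp u"
begin

lemma bil: "bilinear jp"
  and comm: "x \<odot> y = y \<odot> x"
  and jordan: "(x \<odot> x) \<odot> (x \<odot> y) = x \<odot> ((x \<odot> x) \<odot> y)"
  and formally_real: "x \<odot> x + y \<odot> y = 0 \<Longrightarrow> x = 0"
  and unit_left [simp]: "u \<odot> x = x"
  and unit_right [simp]: "x \<odot> u = x"
  using frj unfolding formally_real_jordan_def by (blast, blast, blast, blast, blast, metis)

lemmas jp_linear = bilinear_ladd[OF bil] bilinear_radd[OF bil] bilinear_lmul[OF bil]
  bilinear_rmul[OF bil] bilinear_lneg[OF bil] bilinear_rneg[OF bil] bilinear_lsub[OF bil]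
  bilinear_rsub[OF bil]

lemma jp_zero [simp]: "0 \<odot> x = 0" "x \<odot> 0 = 0"
  by (simp_all add: bilinear_lzero[OF bil] bilinear_rzero[OF bil])

lemma linear_jp: "linear (jp x)"
  using bil unfolding bilinear_def by blast

lemma linear_jp': "linear (\<lambda>x. x \<odot> y)"
  using bil unfolding bilinear_def by blast

lemmas jp_sum_right = linear_sum[OF linear_jp]
lemmas jp_sum_left = linear_sum[OF linear_jp']

lemma square_zero: "x \<odot> x = 0 \<Longrightarrow> x = 0"
  using formally_real[of x 0] by simp

text \<open>Full polarization of the Jordan identity in the variable that occurs three
  times.\<close>

lemma jordan_linearized:
  "(x \<odot> y) \<odot> (z \<odot> w) + (y \<odot> z) \<odot> (x \<odot> w) + (z \<odot> x) \<odot> (y \<odot> w)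
     = z \<odot> ((x \<odot> y) \<odot> w) + x \<odot> ((y \<odot> z) \<odot> w) + y \<odot> ((z \<odot> x) \<odot> w)"
proof -
  \<comment> \<open>\<open>f\<close> is a homogeneous cubic, so the alternating sum over subsets of
    \<open>x, y, z\<close> extracts its symmetric trilinear part.\<close>
  define f where "f = (\<lambda>x. (x \<odot> x) \<odot> (x \<odot> w) - x \<odot> ((x \<odot> x) \<odot> w))"
  have f0: "f v = 0" for v
    by (simp add: f_def jordan)
  have "f (x + y + z) - f (x + y) - f (y + z) - f (x + z) + f x + f y + f z = 0"
    by (simp add: f0)
  moreover have "f (x + y + z) - f (x + y) - f (y + z) - f (x + z) + f x + f y + f z
     = 2 *\<^sub>R ((x \<odot> y) \<odot> (z \<odot> w) + (y \<odot> z) \<odot> (x \<odot> w) + (z \<odot> x) \<odot> (y \<odot> w)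
       - (z \<odot> ((x \<odot> y) \<odot> w) + x \<odot> ((y \<odot> z) \<odot> w) + y \<odot> ((z \<odot> x) \<odot> w)))"
    unfolding f_def
    \<comment> \<open>Pairing with an arbitrary vector turns a vector identity into real arithmetic
      in the products, which the simplifier can close.\<close>
    by (rule eq_by_inner) (simp add: jp_linear comm[of y x] comm[of z y] comm[of z x] inner_simps)
  ultimately show ?thesis by simp
qed

text \<open>The left-hand side is symmetric in all four arguments, so \<open>z\<close> and \<open>w\<close> may be exchanged on the
  right.\<close>
lemma jordan_linearized':
  "(x \<odot> y) \<odot> (z \<odot> w) + (y \<odot> z) \<odot> (x \<odot> w) + (z \<odot> x) \<odot> (y \<odot> w)
     = x \<odot> (z \<odot> (y \<odot> w)) + y \<odot> (z \<odot> (x \<odot> w)) + ((x \<odot> y) \<odot> z) \<odot> w"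
proof -
  have "(x \<odot> y) \<odot> (w \<odot> z) + (y \<odot> w) \<odot> (x \<odot> z) + (w \<odot> x) \<odot> (y \<odot> z)
     = w \<odot> ((x \<odot> y) \<odot> z) + x \<odot> ((y \<odot> w) \<odot> z) + y \<odot> ((w \<odot> x) \<odot> z)"
    by (rule jordan_linearized)
  then show ?thesis
    by (simp add: comm add_ac)
qed

text \<open>With L for multiplication operators this is L_{[L_x,L_z]y} = [[L_x,L_z],L_y]: the
  commutator is a derivation. The two instances used differ by exchanging \<open>x\<close> and
  \<open>z\<close> and have equal left-hand sides, so their right-hand sides can be
  subtracted.\<close>

lemma commutator_derivation:
  "(x \<odot> (z \<odot> y)) \<odot> w - (z \<odot> (x \<odot> y)) \<odot> w
     = x \<odot> (z \<odot> (y \<odot> w)) - z \<odot> (x \<odot> (y \<odot> w)) - y \<odot> (x \<odot> (z \<odot> w)) + y \<odot> (z \<odot> (x \<odot> w))"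
proof -
  note 1 = jordan_linearized'[of x y z w] and 2 = jordan_linearized'[of z y x w]
  have c: "(x \<odot> (z \<odot> y)) = (z \<odot> y) \<odot> x" "(z \<odot> (x \<odot> y)) = (x \<odot> y) \<odot> z"
    by (simp_all add: comm)
  show ?thesis
    unfolding c using 1 2 by (simp add: comm[of y z] comm[of y x] comm[of z x] algebra_simps)
qed

lemma jp_commute_orth:
  assumes "c \<odot> c = c" "c \<odot> a = 0"
  shows "c \<odot> (a \<odot> v) = a \<odot> (c \<odot> v)"
  using jordan_linearized[of c c a v] assms by (simp add: comm[of a c])

section \<open>Power associativity and the spectral theorem\<close>

definition pow :: "'a \<Rightarrow> nat \<Rightarrow> 'a" where
  "pow x n = (jp x ^^ n) u"

lemma pow_0 [simp]: "pow x 0 = u" and pow_Suc: "pow x (Suc n) = x \<odot> pow x n"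
  by (simp_all add: pow_def)

text \<open>The linearized identity writes multiplication by the power m+2 through multiplication by
  the powers m+1, m, 2 and 1. By induction and the Jordan identity all of these commute with
  multiplication by \<open>x\<close>.\<close>

lemma pow_commute: "pow x n \<odot> (x \<odot> v) = x \<odot> (pow x n \<odot> v)"
proof (induction n arbitrary: v rule: less_induct)
  case (less n)
  consider "n = 0" | "n = 1" | m where "n = Suc (Suc m)"
    by (metis One_nat_def not0_implies_Suc)
  then show ?case
  proof cases
    case 3
    have e: "pow x n \<odot> v = 2 *\<^sub>R (pow x (Suc m) \<odot> (x \<odot> v)) + (x \<odot> x) \<odot> (pow x m \<odot> v)
        - x \<odot> (x \<odot> (pow x m \<odot> v)) - pow x m \<odot> (x \<odot> (x \<odot> v))" for v
      using jordan_linearized'[of x "pow x m" x v]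
      by (simp add: 3 pow_Suc comm[of "pow x m" x] comm[of "x \<odot> pow x m" x] scaleR_2 algebra_simps)
    have IH: "pow x m \<odot> (x \<odot> v) = x \<odot> (pow x m \<odot> v)"
      "pow x (Suc m) \<odot> (x \<odot> v) = x \<odot> (pow x (Suc m) \<odot> v)" for v
      using less.IH[of m] less.IH[of "Suc m"] 3 by auto
    show ?thesis
      unfolding e by (simp add: jp_linear IH jordan)
  qed (auto simp: pow_Suc)
qed

lemma pow_add: "pow x m \<odot> pow x n = pow x (m + n)"
  by (induction n) (simp_all add: pow_Suc pow_commute)

lemma pow_assoc: "pow x l \<odot> (pow x m \<odot> pow x n) = (pow x l \<odot> pow x m) \<odot> pow x n"
  by (simp add: pow_add add.assoc)

definition alg :: "'a \<Rightarrow> 'a set" where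
  "alg x = span (range (pow x))"

lemma subspace_alg: "subspace (alg x)"
  by (simp add: alg_def)

lemma unit_in_alg: "u \<in> alg x"
  unfolding alg_def by (metis pow_0 rangeI span_base)

lemma gen_in_alg: "x \<in> alg x"
  unfolding alg_def by (metis pow_0 pow_Suc unit_right rangeI span_base)

lemma linear_zero_on_span:
  assumes "linear f" "\<And>x. x \<in> S \<Longrightarrow> f x = 0" "x \<in> span S"
  shows "f x = 0"
  using linear_eq_0_on_span assms by blast

lemma alg_mult:
  assumes "a \<in> alg x" "b \<in> alg x"
  shows "a \<odot> b \<in> alg x"
proof -
  have 1: "pow x m \<odot> b \<in> alg x" for m
    using assms(2) unfolding alg_def
  proof (induction rule: span_induct)
    case base
    show ?case
      by (simp add: subspace_def jp_linear span_add span_scale span_zero)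
  next
    case (step b)
    then show ?case by (auto simp: pow_add intro: span_base)
  qed
  show ?thesis
    using assms(1) unfolding alg_def
  proof (induction rule: span_induct)
    case base
    show ?case
      by (simp add: subspace_def jp_linear span_add span_scale span_zero)
  next
    case (step a)
    then show ?case using 1 by (auto simp: alg_def)
  qed
qed

lemma alg_assoc:
  assumes a: "a \<in> alg x" and b: "b \<in> alg x" and c: "c \<in> alg x"
  shows "a \<odot> (b \<odot> c) = (a \<odot> b) \<odot> c"
proof -
  have 1: "pow x l \<odot> (pow x m \<odot> c) - (pow x l \<odot> pow x m) \<odot> c = 0" for l m
    by (rule linear_zero_on_span[OF _ _ c[unfolded alg_def]])
       (auto simp: pow_assoc intro!: linearI simp: jp_linear algebra_simps)
  have 2: "pow x l \<odot> (b \<odot> c) - (pow x l \<odot> b) \<odot> c = 0" for l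
    by (rule linear_zero_on_span[OF _ _ b[unfolded alg_def]])
       (use 1 in \<open>auto intro!: linearI simp: jp_linear algebra_simps\<close>)
  have "a \<odot> (b \<odot> c) - (a \<odot> b) \<odot> c = 0"
    by (rule linear_zero_on_span[OF _ _ a[unfolded alg_def]])
       (use 2 in \<open>auto intro!: linearI simp: jp_linear algebra_simps\<close>)
  then show ?thesis by simp
qed

end

section \<open>Polynomials in one element and its eigenvectors\<close>

text \<open>The order of the factors matters for the later action on vectors: the linear factor is
  applied first, but the quadratic one last.\<close>

lemma real_poly_factor:
  fixes p :: "real poly"
  assumes "degree p > 0"
  obtains (lin) l k where "p = k * [:-l, 1:]"
    | (quad) a b k where "b \<noteq> 0" "p = [:a\<^sup>2 + b\<^sup>2, -2 * a, 1:] * k"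
proof -
  define ev where "ev = (\<lambda>p z. poly (map_poly complex_of_real p) z)"
  have ev_pCons: "ev (pCons a p) z = of_real a + z * ev p z" for a p z
    unfolding ev_def by (cases "pCons a p = 0") (auto simp: map_poly_pCons)
  have ev_0: "ev 0 z = 0" for z by (simp add: ev_def)
  have ev_add: "ev (p + q) z = ev p z + ev q z" for p q z
    by (induction p q rule: poly_induct2) (simp_all add: ev_pCons ev_0 algebra_simps)
  have ev_smult: "ev (smult a q) z = of_real a * ev q z" for a q z
    by (induction q) (simp_all add: ev_pCons ev_0 algebra_simps)
  have ev_mult: "ev (p * q) z = ev p z * ev q z" for p q z
    by (induction p) (simp_all add: ev_pCons ev_0 ev_add ev_smult algebra_simps)
  have ev_real: "ev p (of_real t) = of_real (poly p t)" for p t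
    by (induction p) (simp_all add: ev_pCons ev_0)
  have "degree (map_poly complex_of_real p) > 0"
    using assms by (simp add: degree_map_poly)
  then have "\<not> constant (poly (map_poly complex_of_real p))"
    by (simp add: constant_degree)
  then obtain z where z: "ev p z = 0"
    using fundamental_theorem_of_algebra unfolding ev_def by blast
  show thesis
  proof (cases "Im z = 0")
    case True
    then have "z = of_real (Re z)" by (simp add: complex_eq_iff)
    then have "poly p (Re z) = 0" using z ev_real by (metis of_real_eq_0_iff)
    then have "[:- Re z, 1:] dvd p" by (simp add: poly_eq_0_iff_dvd)
    then obtain k where "p = [:- Re z, 1:] * k" by blast
    then show thesis using lin by (simp only: mult.commute)
  next
    case False
    define q where "q = [:(Re z)\<^sup>2 + (Im z)\<^sup>2, -2 * Re z, 1:]"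
    have qz: "ev q z = 0"
      unfolding q_def by (simp add: ev_pCons ev_0 complex_eq_iff power2_eq_square algebra_simps)
    have dq: "q \<noteq> 0" "degree q = 2" by (simp_all add: q_def)
    have pq: "p = q * (p div q) + p mod q" by simp
    then have rz: "ev (p mod q) z = 0"
      using z qz ev_add ev_mult by (metis add_0 mult_zero_left)
    \<comment> \<open>The remainder is c + d t and vanishes at the nonreal \<open>z\<close>, so its
      imaginary part forces d = 0 and then c = 0.\<close>
    have "degree (p mod q) < 2"
      using dq degree_mod_less'[of q p] by (cases "p mod q = 0") auto
    moreover obtain c k where ck: "p mod q = pCons c k" by (rule pCons_cases)
    ultimately have "degree k = 0" by (cases "k = 0") auto
    then obtain d where "k = [:d:]" by (rule degree_eq_zeroE)
    with ck have r: "p mod q = [:c, d:]" by simp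
    have "of_real c + z * of_real d = 0"
      using rz unfolding r by (simp add: ev_pCons ev_0)
    then have "c + Re z * d = 0" "Im z * d = 0" by (auto simp: complex_eq_iff)
    with False have "d = 0" "c = 0" by auto
    with r pq have "p = q * (p div q)" by simp
    then show thesis using quad[OF False] unfolding q_def by blast
  qed
qed

context euclidean_jordan
begin

text \<open>Horner's scheme for p(L_x) v, where L_x is multiplication by \<open>x\<close>. As
  operators are composed, products of polynomials behave well without associativity of the
  algebra.\<close>

definition pact :: "'a \<Rightarrow> real poly \<Rightarrow> 'a \<Rightarrow> 'a" where
  "pact x p v = fold_coeffs (\<lambda>a w. a *\<^sub>R v + x \<odot> w) p 0"

lemma pact_0 [simp]: "pact x 0 v = 0"
  by (simp add: pact_def)

lemma pact_pCons [simp]: "pact x (pCons a p) v = a *\<^sub>R v + x \<odot> pact x p v"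
  by (cases "p = 0"; cases "a = 0") (simp_all add: pact_def)

lemma pact_add: "pact x (p + q) v = pact x p v + pact x q v"
  by (induction p q rule: poly_induct2) (simp_all add: jp_linear algebra_simps)

lemma pact_smult: "pact x (smult a p) v = a *\<^sub>R pact x p v"
  by (induction p) (simp_all add: jp_linear algebra_simps)

lemma pact_mult: "pact x (p * q) v = pact x p (pact x q v)"
  by (induction p) (simp_all add: pact_add pact_smult)

lemma pact_sum: "pact x (\<Sum>i\<in>I. p i) v = (\<Sum>i\<in>I. pact x (p i) v)"
  by (induction I rule: infinite_finite_induct) (simp_all add: pact_add)

lemma pact_monom: "pact x (monom a n) u = a *\<^sub>R pow x n"
  by (induction n) (simp_all add: monom_0 monom_Suc pow_Suc jp_linear)

lemma pact_alg: "v \<in> alg x \<Longrightarrow> pact x p v \<in> alg x"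
  by (induction p)
     (simp_all add: subspace_0 subspace_alg subspace_add subspace_scale alg_mult gen_in_alg)

lemma annihilating_poly: obtains p where "p \<noteq> 0" "pact x p u = 0"
\<comment> \<open>Linear dependence concerns sets. If two powers coincide, the set of powers may be
  too small to be dependent, and the difference of the two monomials annihilates instead.\<close>
proof (cases "inj_on (pow x) {..DIM('a)}")
  case True
  let ?S = "pow x ` {..DIM('a)}"
  have "card ?S = DIM('a) + 1" using True by (simp add: card_image)
  then have "dependent ?S" using dependent_biggerset[of ?S] by simp
  then obtain g v where g: "v \<in> ?S" "g v \<noteq> 0" "(\<Sum>v\<in>?S. g v *\<^sub>R v) = 0"
    using dependent_finite[of ?S] by auto
  define p where "p = (\<Sum>i\<le>DIM('a). monom (g (pow x i)) i)"
  obtain i where i: "i \<le> DIM('a)" "v = pow x i" using g(1) by auto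
  have "coeff p i = g v"
    using i by (simp add: p_def coeff_sum coeff_monom if_distrib cong: if_cong)
  then have "p \<noteq> 0" using g(2) by auto
  moreover have "pact x p u = 0"
    using g(3) by (simp add: p_def pact_sum pact_monom sum.reindex[OF True])
  ultimately show ?thesis using that by blast
next
  case False
  then obtain i j where ij: "i \<noteq> j" "pow x i = pow x j" by (auto simp: inj_on_def)
  define p where "p = monom (1::real) i + smult (-1) (monom 1 j)"
  have "coeff p i = 1" using ij by (simp add: p_def)
  then have "p \<noteq> 0" by auto
  moreover have "pact x p u = 0"
    unfolding p_def pact_add pact_smult pact_monom using ij(2) by simp
  ultimately show ?thesis using that by blast
qed

text \<open>In the associative subalgebra, the factor \<open>x - a u\<close> may be moved from one
  side of a product to the other.\<close>

lemma alg_shift: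
  assumes "w \<in> alg x" "t \<in> alg x"
  shows "(x \<odot> w - a *\<^sub>R w) \<odot> t = w \<odot> (x \<odot> t - a *\<^sub>R t)"
proof -
  have "(x \<odot> w) \<odot> t = w \<odot> (x \<odot> t)"
    using alg_assoc[of w x x t] assms gen_in_alg by (simp add: comm[of w x])
  then show ?thesis by (simp add: jp_linear)
qed

text \<open>Formal reality rules out nonreal roots and, because squares do not vanish, multiple ones.\<close>
lemma alg_eigenvectors:
  assumes "p \<noteq> 0" "v \<in> alg x" "pact x p v = 0"
  shows "\<exists>S e. finite S \<and> v = (\<Sum>s\<in>S. e s) \<and> (\<forall>s\<in>S. e s \<in> alg x \<and> x \<odot> e s = s *\<^sub>R e s)"
  using assms
proof (induction "degree p" arbitrary: p v rule: less_induct)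
  case less
  show ?case
  proof (cases "degree p = 0")
    case True
    then obtain a where "p = [:a:]" by (metis degree_eq_zeroE)
    with less.prems have "v = 0" by simp
    then show ?thesis by (intro exI[of _ "{}"]) simp
  next
    case False
    then have "degree p > 0" by simp
    then show ?thesis
    proof (cases p rule: real_poly_factor)
      case (lin l k)
      have k0: "k \<noteq> 0" using lin less.prems(1) by auto
      then have "degree p = degree k + degree [:-l, 1:]"
        unfolding lin by (intro degree_mult_eq) auto
      then have dk: "degree k < degree p" by simp
      define v' where "v' = x \<odot> v - l *\<^sub>R v"
      have v'a: "v' \<in> alg x"
        unfolding v'_def
        using less.prems(2) gen_in_alg by (intro subspace_diff subspace_scale subspace_alg alg_mult)
      have "pact x k v' = 0"
        using less.prems(3) unfolding lin pact_mult v'_def by (simp add: algebra_simps)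
      from less.hyps[OF dk k0 v'a this] obtain S w where
        S: "finite S" "v' = (\<Sum>s\<in>S. w s)" "\<And>s. s \<in> S \<Longrightarrow> w s \<in> alg x"
          "\<And>s. s \<in> S \<Longrightarrow> x \<odot> w s = s *\<^sub>R w s" by blast
      \<comment> \<open>\<open>g s\<close> is a preimage of \<open>w s\<close> under multiplication
        by \<open>x - l u\<close>. Subtracting these from \<open>v\<close> leaves \<open>v0\<close>,
        whose image \<open>t\<close> can only be the component of \<open>v'\<close> for the
        eigenvalue \<open>l\<close>.\<close>
      define g where "g = (\<lambda>s. (1 / (s - l)) *\<^sub>R w s)"
      define v0 where "v0 = v - (\<Sum>s\<in>S - {l}. g s)"
      define t where "t = x \<odot> v0 - l *\<^sub>R v0"
      have g: "g s \<in> alg x" "x \<odot> g s = s *\<^sub>R g s" "x \<odot> g s - l *\<^sub>R g s = w s"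
        if "s \<in> S - {l}" for s
      proof -
        have "x \<odot> g s - l *\<^sub>R g s = (s / (s - l) - l / (s - l)) *\<^sub>R w s"
          using that S(4) by (simp add: g_def jp_linear scaleR_left_diff_distrib)
        also have "s / (s - l) - l / (s - l) = 1"
          using that by (simp add: diff_divide_distrib[symmetric])
        finally show "x \<odot> g s - l *\<^sub>R g s = w s" by simp
      qed (use that S in \<open>auto simp: g_def jp_linear intro!: subspace_scale subspace_alg\<close>)
      have v0a: "v0 \<in> alg x"
        unfolding v0_def using less.prems(2) g(1)
        by (intro subspace_diff subspace_sum subspace_alg) auto
      have "t = v' - (\<Sum>s\<in>S - {l}. x \<odot> g s - l *\<^sub>R g s)"
        unfolding t_def v0_def v'_def
        by (simp add: bilinear_rsub[OF bil] jp_sum_right scaleR_sum_right sum_subtractf scaleR_diff_right)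
      also have "\<dots> = v' - (\<Sum>s\<in>S - {l}. w s)" using g(3) by simp
      finally have tv: "t = v' - (\<Sum>s\<in>S - {l}. w s)" .
      then have tcases: "t = (if l \<in> S then w l else 0)"
        using S(1,2) by (simp add: sum_diff1)
      then have xt: "x \<odot> t - l *\<^sub>R t = 0" using S(4) by simp
      have "t \<in> alg x" using tcases S(3) subspace_0[OF subspace_alg] by auto
      \<comment> \<open>A nonzero \<open>t\<close> would be an eigenvector in the image of
        \<open>x - l u\<close>, as for a multiple root; moving the factor across shows that its
        square is zero.\<close>
      then have "t \<odot> t = v0 \<odot> (x \<odot> t - l *\<^sub>R t)"
        using alg_shift[OF v0a, of t l] by (simp add: t_def)
      then have "t = 0" using xt square_zero[of t] by simp
      then have xv0: "x \<odot> v0 = l *\<^sub>R v0" by (simp add: t_def)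
      define e where "e = (\<lambda>s. if s = l then v0 else g s)"
      have "(\<Sum>s\<in>insert l S. e s) = e l + (\<Sum>s\<in>S - {l}. e s)"
        using S(1) by (simp add: sum.insert_remove)
      also have "(\<Sum>s\<in>S - {l}. e s) = (\<Sum>s\<in>S - {l}. g s)"
        by (rule sum.cong) (auto simp: e_def)
      finally have "v = (\<Sum>s\<in>insert l S. e s)" by (simp add: e_def v0_def)
      moreover have "\<forall>s\<in>insert l S. e s \<in> alg x \<and> x \<odot> e s = s *\<^sub>R e s"
        using v0a xv0 g by (auto simp: e_def)
      ultimately show ?thesis using S(1)
        by (intro exI[of _ "insert l S"] exI[of _ e]) blast
    next
      case (quad a b k)
      have k0: "k \<noteq> 0" using quad less.prems(1) by auto
      then have "degree p = degree [:a\<^sup>2 + b\<^sup>2, -2 * a, 1:] + degree k"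
        unfolding quad(2) by (intro degree_mult_eq) auto
      then have dk: "degree k < degree p" by simp
      define w where "w = pact x k v"
      have wa: "w \<in> alg x" using less.prems(2) by (simp add: w_def pact_alg)
      define t where "t = x \<odot> w - a *\<^sub>R w"
      have ta: "t \<in> alg x"
        unfolding t_def using wa gen_in_alg
        by (intro subspace_diff subspace_scale subspace_alg alg_mult)
      \<comment> \<open>This is ((x - a)^2 + b^2) w = 0. With t = (x - a) w it gives t^2 = - b^2
        w^2, and formal reality kills \<open>b w\<close>.\<close>
      have "(a\<^sup>2 + b\<^sup>2) *\<^sub>R w + x \<odot> ((-2 * a) *\<^sub>R w + x \<odot> w) = 0"
        using less.prems(3) unfolding quad(2) pact_mult w_def by simp
      moreover have "x \<odot> t - a *\<^sub>R t
          = ((a\<^sup>2 + b\<^sup>2) *\<^sub>R w + x \<odot> ((-2 * a) *\<^sub>R w + x \<odot> w)) - b\<^sup>2 *\<^sub>R w"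
        unfolding t_def
        by (rule eq_by_inner) (simp add: jp_linear inner_simps algebra_simps power2_eq_square)
      ultimately have "x \<odot> t - a *\<^sub>R t = - (b\<^sup>2 *\<^sub>R w)" by simp
      then have "t \<odot> t = - (b\<^sup>2 *\<^sub>R (w \<odot> w))"
        using alg_shift[OF wa ta, of a] by (simp add: t_def jp_linear)
      then have "(b *\<^sub>R w) \<odot> (b *\<^sub>R w) + t \<odot> t = 0"
        by (simp add: jp_linear power2_eq_square)
      then have "b *\<^sub>R w = 0" by (rule formally_real)
      then have "pact x k v = 0" using quad(1) by (simp add: w_def)
      then show ?thesis using less.hyps[OF dk k0 less.prems(2)] by blast
    qed
  qed
qed

section \<open>Orthogonal systems of idempotents and the spectral theorem\<close>

definition osys :: "'a set \<Rightarrow> bool" where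
  "osys C \<longleftrightarrow> finite C \<and> (\<forall>c\<in>C. c \<odot> c = c) \<and> (\<forall>c\<in>C. \<forall>d\<in>C. c \<noteq> d \<longrightarrow> c \<odot> d = 0)"

lemma osysD:
  assumes "osys C"
  shows "finite C" "c \<in> C \<Longrightarrow> c \<odot> c = c" "c \<in> C \<Longrightarrow> d \<in> C \<Longrightarrow> c \<noteq> d \<Longrightarrow> c \<odot> d = 0"
  using assms by (auto simp: osys_def)

lemma osys_subset: "osys C \<Longrightarrow> D \<subseteq> C \<Longrightarrow> osys D"
  unfolding osys_def by (meson finite_subset subsetD)

text \<open>The unit itself is split into eigenvectors of multiplication by \<open>x\<close>.
  Components for different eigenvalues annihilate each other, and multiplying a component by
  \<open>u\<close> then shows that it is idempotent.\<close>

theorem spectral: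
  obtains C f where "osys C" "0 \<notin> C" "sum id C = u" "C \<subseteq> alg x"
    "\<And>c. c \<in> C \<Longrightarrow> x \<odot> c = f c *\<^sub>R c" "x = (\<Sum>c\<in>C. f c *\<^sub>R c)"
proof -
  obtain p where "p \<noteq> 0" "pact x p u = 0" by (rule annihilating_poly)
  from alg_eigenvectors[OF this(1) unit_in_alg this(2)] obtain S e where
    S: "finite S" "u = (\<Sum>s\<in>S. e s)" "\<And>s. s \<in> S \<Longrightarrow> e s \<in> alg x"
      "\<And>s. s \<in> S \<Longrightarrow> x \<odot> e s = s *\<^sub>R e s" by blast
  \<comment> \<open>Without the zero components \<open>e\<close> is injective, so the family can be
    turned into a set with eigenvalues attached.\<close>
  define T where "T = {s \<in> S. e s \<noteq> 0}"
  have T: "T \<subseteq> S" "finite T" using S(1) by (auto simp: T_def)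
  have uT: "u = (\<Sum>s\<in>T. e s)"
    unfolding S(2) by (rule sum.mono_neutral_right) (use S(1) in \<open>auto simp: T_def\<close>)
  have orth: "e s \<odot> e t = 0" if "s \<in> T" "t \<in> T" "s \<noteq> t" for s t
  proof -
    have "(x \<odot> e s) \<odot> e t = e s \<odot> (x \<odot> e t)"
      using alg_shift[of "e s" x "e t" 0] that T S(3) by auto
    moreover have "x \<odot> e s = s *\<^sub>R e s" "x \<odot> e t = t *\<^sub>R e t"
      using that T S(4) by auto
    ultimately have "(s - t) *\<^sub>R (e s \<odot> e t) = 0"
      by (simp add: jp_linear algebra_simps)
    then show ?thesis using that(3) by simp
  qed
  have idem: "e s \<odot> e s = e s" if "s \<in> T" for s
  proof -
    have "e s = e s \<odot> (\<Sum>t\<in>T. e t)" by (simp flip: uT)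
    also have "\<dots> = (\<Sum>t\<in>T. if t = s then e s \<odot> e s else 0)"
      unfolding jp_sum_right by (rule sum.cong) (use orth that in auto)
    also have "\<dots> = e s \<odot> e s" using that T by simp
    finally show ?thesis by simp
  qed
  have inj: "inj_on e T"
    using orth idem by (intro inj_onI) (metis (mono_tags, lifting) T_def mem_Collect_eq)
  define f where "f = inv_into T e"
  have f: "f (e s) = s" if "s \<in> T" for s using inj that by (simp add: f_def)
  show thesis
  proof (rule that[of "e ` T" f])
    show "osys (e ` T)" using T orth idem inj by (auto simp: osys_def inj_on_def)
    show "0 \<notin> e ` T" by (auto simp: T_def)
    show "sum id (e ` T) = u" using inj uT by (simp add: sum.reindex)
    show "e ` T \<subseteq> alg x" using S(3) T by auto
    show ev: "x \<odot> c = f c *\<^sub>R c" if "c \<in> e ` T" for c using that f S(4) T by auto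
    have "x = x \<odot> (\<Sum>s\<in>T. e s)" by (simp flip: uT)
    also have "\<dots> = (\<Sum>s\<in>T. f (e s) *\<^sub>R e s)"
      unfolding jp_sum_right by (rule sum.cong) (use ev in auto)
    also have "\<dots> = (\<Sum>c\<in>e ` T. f c *\<^sub>R c)" using inj by (simp add: sum.reindex)
    finally show "x = (\<Sum>c\<in>e ` T. f c *\<^sub>R c)" .
  qed
qed

lemma osys_mult:
  assumes "osys C"
  shows "(\<Sum>c\<in>C. f c *\<^sub>R c) \<odot> (\<Sum>c\<in>C. g c *\<^sub>R c) = (\<Sum>c\<in>C. (f c * g c) *\<^sub>R c)"
proof -
  have "(\<Sum>c\<in>C. f c *\<^sub>R c) \<odot> (\<Sum>d\<in>C. g d *\<^sub>R d)
      = (\<Sum>c\<in>C. \<Sum>d\<in>C. if d = c then (f c * g c) *\<^sub>R c else 0)"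
    unfolding jp_sum_left jp_sum_right
    by (intro sum.cong refl) (use osysD[OF assms] in \<open>auto simp: jp_linear mult.commute\<close>)
  then show ?thesis using osysD(1)[OF assms] by simp
qed

lemma osys_comp:
  assumes "osys C" "d \<in> C"
  shows "d \<odot> (\<Sum>c\<in>C. f c *\<^sub>R c) = f d *\<^sub>R d"
proof -
  have "d \<odot> (\<Sum>c\<in>C. f c *\<^sub>R c) = (\<Sum>c\<in>C. if c = d then f d *\<^sub>R d else 0)"
    unfolding jp_sum_right
    by (intro sum.cong refl) (use osysD[OF assms(1)] assms(2) in \<open>auto simp: jp_linear\<close>)
  then show ?thesis using osysD(1)[OF assms(1)] assms(2) by simp
qed

end

section \<open>The trace form and the Peirce decomposition\<close>

definition trace_of :: "('a::euclidean_space \<Rightarrow> 'a) \<Rightarrow> real" where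
  "trace_of f = (\<Sum>b\<in>Basis. f b \<bullet> b)"

lemma trace_of_add: "trace_of (\<lambda>x. f x + g x) = trace_of f + trace_of g"
  and trace_of_diff: "trace_of (\<lambda>x. f x - g x) = trace_of f - trace_of g"
  and trace_of_scaleR: "trace_of (\<lambda>x. r *\<^sub>R f x) = r * trace_of f"
  by (simp_all add: trace_of_def inner_add_left inner_diff_left sum.distrib sum_subtractf sum_distrib_left)

lemma trace_of_comp_commute:
  fixes f g :: "'a::euclidean_space \<Rightarrow> 'a"
  assumes "linear f" "linear g"
  shows "trace_of (\<lambda>x. f (g x)) = trace_of (\<lambda>x. g (f x))"
proof -
  have e: "f (g b) \<bullet> b = (\<Sum>b'\<in>Basis. (g b \<bullet> b') * (f b' \<bullet> b))"
    if "linear f" for f g :: "'a \<Rightarrow> 'a" and b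
  proof -
    have "f (g b) = f (\<Sum>b'\<in>Basis. (g b \<bullet> b') *\<^sub>R b')" by (simp add: euclidean_representation)
    also have "\<dots> = (\<Sum>b'\<in>Basis. (g b \<bullet> b') *\<^sub>R f b')"
      using that by (simp add: linear_sum linear_scale)
    finally show ?thesis by (simp add: inner_sum_left)
  qed
  have "trace_of (\<lambda>x. f (g x)) = (\<Sum>b\<in>Basis. \<Sum>b'\<in>Basis. (g b \<bullet> b') * (f b' \<bullet> b))"
    unfolding trace_of_def by (simp only: e[OF assms(1)])
  also have "\<dots> = (\<Sum>b'\<in>Basis. \<Sum>b\<in>Basis. (f b' \<bullet> b) * (g b \<bullet> b'))"
    by (subst sum.swap) (simp only: mult.commute)
  also have "\<dots> = trace_of (\<lambda>x. g (f x))"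
    unfolding trace_of_def by (simp only: e[OF assms(2)])
  finally show ?thesis .
qed

text \<open>\<open>P\<close> is compared with the orthogonal projection \<open>E\<close> onto its range: \<open>P E = E\<close> and \<open>E P = P\<close>
  have the same trace.\<close>
lemma trace_of_projection:
  fixes P :: "'a::euclidean_space \<Rightarrow> 'a"
  assumes P: "linear P" "\<And>x. P (P x) = P x"
  shows "trace_of P = real (dim (range P))"
proof -
  have "subspace (range P)" using P(1) by (simp add: linear_subspace_image)
  then obtain B where B: "B \<subseteq> range P" "pairwise orthogonal B" "\<And>x. x \<in> B \<Longrightarrow> norm x = 1"
     "independent B" "card B = dim (range P)" "span B = range P"
    by (rule orthonormal_basis_subspace) blast
  have fin: "finite B" using B(4) independent_bound by blast
  define E where "E = (\<lambda>x. \<Sum>b\<in>B. (x \<bullet> b) *\<^sub>R b)"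
  have linE: "linear E"
    unfolding E_def
    by (intro linearI) (simp_all add: inner_add_left scaleR_add_left sum.distrib scaleR_sum_right)
  have "E b = b" if "b \<in> B" for b
  proof -
    have "E b = (\<Sum>b'\<in>B. if b' = b then b else 0)"
      unfolding E_def
    proof (rule sum.cong)
      fix b' assume "b' \<in> B"
      then show "(b \<bullet> b') *\<^sub>R b' = (if b' = b then b else 0)"
        using B(2,3) that by (auto simp: pairwise_def orthogonal_def norm_eq_1)
    qed simp
    then show ?thesis using that fin by simp
  qed
  then have "E x = x" if "x \<in> span B" for x
    using linear_eq_on_span[OF linE linear_id, of B x] that by simp
  then have EP: "E (P x) = P x" for x using B(6) by auto
  have "E x \<in> span B" for x unfolding E_def by (intro span_sum span_scale span_base)
  then have PE: "P (E x) = E x" for x using B(6) P(2) by (metis imageE)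
  have "trace_of P = trace_of E"
    using trace_of_comp_commute[OF P(1) linE] by (simp add: EP PE)
  also have "\<dots> = (\<Sum>i\<in>Basis. \<Sum>b\<in>B. (b \<bullet> i) * (b \<bullet> i))"
    unfolding trace_of_def E_def by (intro sum.cong refl) (simp add: inner_sum_left, simp add: inner_commute)
  also have "\<dots> = (\<Sum>b\<in>B. b \<bullet> b)"
    by (subst sum.swap) (simp flip: euclidean_inner)
  also have "\<dots> = (\<Sum>b\<in>B. 1)"
    using B(3) by (intro sum.cong) (simp_all add: norm_eq_1)
  finally show ?thesis using B(5) by simp
qed

context euclidean_jordan
begin

section \<open>Peirce projections of an idempotent\<close>

text \<open>Multiplication by an idempotent is a root of 2t^3 - 3t^2 + t, so its eigenvalues are
  among 0, 1/2 and 1.\<close>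

lemma peirce_cubic:
  assumes "c \<odot> c = c"
  shows "2 *\<^sub>R (c \<odot> (c \<odot> (c \<odot> v))) = 3 *\<^sub>R (c \<odot> (c \<odot> v)) - c \<odot> v"
proof (rule eq_by_inner)
  fix i
  show "2 *\<^sub>R (c \<odot> (c \<odot> (c \<odot> v))) \<bullet> i = (3 *\<^sub>R (c \<odot> (c \<odot> v)) - c \<odot> v) \<bullet> i"
    using arg_cong[OF jordan_linearized'[of c c c v], of "\<lambda>w. w \<bullet> i"] assms
    by (simp add: inner_simps)
qed

text \<open>\<open>pe1\<close>, \<open>peh\<close> and \<open>pe0\<close> are the Lagrange
  interpolation polynomials for the nodes 1, 1/2 and 0, evaluated at multiplication by
  \<open>c\<close>; for idempotent \<open>c\<close> they project onto the three Peirce spaces, and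
  \<open>pe1 c\<close> is then \<open>Uop jp c\<close>.\<close>

definition pe1 :: "'a \<Rightarrow> 'a \<Rightarrow> 'a" where
  "pe1 c v = 2 *\<^sub>R (c \<odot> (c \<odot> v)) - c \<odot> v"
definition peh :: "'a \<Rightarrow> 'a \<Rightarrow> 'a" where
  "peh c v = 4 *\<^sub>R (c \<odot> v) - 4 *\<^sub>R (c \<odot> (c \<odot> v))"
definition pe0 :: "'a \<Rightarrow> 'a \<Rightarrow> 'a" where
  "pe0 c v = v - 3 *\<^sub>R (c \<odot> v) + 2 *\<^sub>R (c \<odot> (c \<odot> v))"

lemma peirce_sum: "pe1 c v + peh c v + pe0 c v = v"
  unfolding pe1_def peh_def pe0_def by (rule eq_by_inner) (simp add: inner_simps)

lemma peirce_jp: "c \<odot> v = pe1 c v + (1/2) *\<^sub>R peh c v"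
  unfolding pe1_def peh_def by (rule eq_by_inner) (simp add: inner_simps field_simps)

lemma
  assumes "c \<odot> c = c"
  shows peirce1: "c \<odot> pe1 c v = pe1 c v"
    and peirceh: "c \<odot> peh c v = (1/2) *\<^sub>R peh c v"
    and peirce0: "c \<odot> pe0 c v = 0"
proof -
  define w where "w = c \<odot> (c \<odot> (c \<odot> v))"
  have e: "w \<bullet> i = 3 / 2 * (c \<odot> (c \<odot> v) \<bullet> i) - 1 / 2 * (c \<odot> v \<bullet> i)" for i
    using arg_cong[OF peirce_cubic[OF assms, of v], of "\<lambda>w. w \<bullet> i"]
    by (simp add: inner_simps w_def)
  show "c \<odot> pe1 c v = pe1 c v"
    by (rule eq_by_inner) (simp add: pe1_def jp_linear inner_simps e flip: w_def)
  show "c \<odot> peh c v = (1/2) *\<^sub>R peh c v"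
    by (rule eq_by_inner) (simp add: peh_def jp_linear inner_simps e flip: w_def)
  show "c \<odot> pe0 c v = 0"
    by (rule eq_by_inner) (simp add: pe0_def jp_linear inner_simps e flip: w_def)
qed

lemma linear_pe: "linear (pe1 c)" "linear (peh c)" "linear (pe0 c)"
  by (intro linearI; simp add: pe1_def peh_def pe0_def jp_linear algebra_simps)+

lemma pe1_fix: "c \<odot> v = v \<Longrightarrow> pe1 c v = v"
  by (simp add: pe1_def scaleR_2)

lemma peh_fix: "c \<odot> v = (1/2) *\<^sub>R v \<Longrightarrow> peh c v = v"
  by (simp add: peh_def jp_linear scaleR_2)

lemma trace_idempotent:
  assumes "c \<odot> c = c"
  shows "trace_of (jp c) = real (dim (range (pe1 c))) + real (dim (range (peh c))) / 2"
proof -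
  have "trace_of (jp c) = trace_of (\<lambda>v. pe1 c v + (1/2) *\<^sub>R peh c v)"
    using peirce_jp[of c] by presburger
  also have "\<dots> = trace_of (pe1 c) + trace_of (peh c) / 2"
    by (simp add: trace_of_add trace_of_scaleR)
  finally show ?thesis
    using trace_of_projection[of "pe1 c"] trace_of_projection[of "peh c"] linear_pe
      pe1_fix[OF peirce1[OF assms]] peh_fix[OF peirceh[OF assms]] by simp
qed

text \<open>The Peirce 1-space contains \<open>c\<close> itself, so its dimension is at least
  one.\<close>

lemma trace_idempotent_ge_1:
  assumes "c \<odot> c = c" "c \<noteq> 0"
  shows "trace_of (jp c) \<ge> 1"
proof -
  have "c \<in> range (pe1 c)" using pe1_fix[OF assms(1)] by (metis rangeI)
  then have "dim (range (pe1 c)) \<noteq> 0" using assms(2) by (auto simp: dim_eq_0)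
  then have "real (dim (range (pe1 c))) \<ge> 1" by (simp del: dim_eq_0)
  then show ?thesis unfolding trace_idempotent[OF assms(1)] by simp
qed

section \<open>The trace form\<close>

definition tf :: "'a \<Rightarrow> 'a \<Rightarrow> real" where
  "tf x y = trace_of (jp (x \<odot> y))"

lemma tf_commute: "tf x y = tf y x"
  by (simp add: tf_def comm)

lemma tf_linear:
  "tf (x + y) z = tf x z + tf y z" "tf z (x + y) = tf z x + tf z y"
  "tf (r *\<^sub>R x) z = r * tf x z" "tf z (r *\<^sub>R x) = r * tf z x"
  "tf (x - y) z = tf x z - tf y z" "tf z (x - y) = tf z x - tf z y"
  by (simp_all add: tf_def jp_linear trace_of_def inner_add_left inner_diff_left sum.distrib
      sum_subtractf sum_distrib_left)

lemma tf_0 [simp]: "tf 0 x = 0" "tf x 0 = 0"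
  by (simp_all add: tf_def trace_of_def)

lemma tf_sum: "tf (\<Sum>i\<in>I. f i) x = (\<Sum>i\<in>I. tf (f i) x)" "tf x (\<Sum>i\<in>I. f i) = (\<Sum>i\<in>I. tf x (f i))"
  by (induction I rule: infinite_finite_induct) (simp_all add: tf_linear)

text \<open>The operator of \<open>x (z y) - z (x y)\<close> is a commutator, hence has trace zero.\<close>
lemma tf_assoc: "tf (x \<odot> y) z = tf x (y \<odot> z)"
proof -
  have "trace_of (\<lambda>w. (x \<odot> (z \<odot> y)) \<odot> w - (z \<odot> (x \<odot> y)) \<odot> w) =
     trace_of (\<lambda>w. x \<odot> (z \<odot> (y \<odot> w))) - trace_of (\<lambda>w. z \<odot> (x \<odot> (y \<odot> w)))
     - trace_of (\<lambda>w. y \<odot> (x \<odot> (z \<odot> w))) + trace_of (\<lambda>w. y \<odot> (z \<odot> (x \<odot> w)))"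
    unfolding commutator_derivation by (simp only: trace_of_add trace_of_diff)
  moreover have "trace_of (\<lambda>w. a \<odot> (b \<odot> (y \<odot> w))) = trace_of (\<lambda>w. y \<odot> (a \<odot> (b \<odot> w)))" for a b
    using trace_of_comp_commute[OF linear_compose[OF linear_jp[of b] linear_jp[of a]] linear_jp[of y]]
    by (simp add: o_def)
  ultimately have "trace_of (jp (x \<odot> (z \<odot> y))) = trace_of (jp (z \<odot> (x \<odot> y)))"
    by (simp add: trace_of_diff)
  then show ?thesis by (simp add: tf_def comm)
qed

lemma tf_idempotent: "c \<odot> c = c \<Longrightarrow> c \<noteq> 0 \<Longrightarrow> tf c c \<ge> 1"
  using trace_idempotent_ge_1 by (simp add: tf_def)

lemma tf_osys:
  assumes "osys C"
  shows "tf (\<Sum>c\<in>C. f c *\<^sub>R c) (\<Sum>c\<in>C. g c *\<^sub>R c) = (\<Sum>c\<in>C. f c * g c * tf c c)"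
proof -
  have "tf (\<Sum>c\<in>C. f c *\<^sub>R c) (\<Sum>c\<in>C. g c *\<^sub>R c) = tf (\<Sum>c\<in>C. (f c * g c) *\<^sub>R c) u"
    unfolding osys_mult[OF assms, symmetric] tf_assoc by simp
  also have "\<dots> = (\<Sum>c\<in>C. f c * g c * tf c u)"
    by (simp add: tf_sum tf_linear)
  also have "\<dots> = (\<Sum>c\<in>C. f c * g c * tf c c)"
    by (intro sum.cong refl) (simp add: tf_def osysD(2)[OF assms])
  finally show ?thesis .
qed

lemma tf_pos: "x \<noteq> 0 \<Longrightarrow> tf x x > 0"
proof -
  assume "x \<noteq> 0"
  obtain C f where C: "osys C" "0 \<notin> C" "x = (\<Sum>c\<in>C. f c *\<^sub>R c)"
    by (rule spectral[of x]) blast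
  have tc: "tf c c > 0" if "c \<in> C" for c
  proof -
    have "c \<noteq> 0" using that C(2) by auto
    then show ?thesis using tf_idempotent[OF osysD(2)[OF C(1) that]] by simp
  qed
  have e: "tf x x = (\<Sum>c\<in>C. f c * f c * tf c c)"
    using tf_osys[OF C(1), of f f] by (simp flip: C(3))
  have "\<not> (\<forall>c\<in>C. f c = 0)"
  proof
    assume "\<forall>c\<in>C. f c = 0"
    then have "(\<Sum>c\<in>C. f c *\<^sub>R c) = 0" by (intro sum.neutral) simp
    with \<open>x \<noteq> 0\<close> C(3) show False by metis
  qed
  then obtain c where c: "c \<in> C" "f c \<noteq> 0" by blast
  have "f c * f c > 0" using c(2) by (meson not_real_square_gt_zero)
  then show ?thesis
    unfolding e using osysD(1)[OF C(1)] c(1) tc by (intro sum_pos2[of C c]) (auto simp: less_imp_le)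
qed

lemma tf_nonneg: "tf x x \<ge> 0"
  using tf_pos[of x] by (cases "x = 0") auto

lemma tf_eq_0: "tf x x = 0 \<longleftrightarrow> x = 0"
  using tf_pos[of x] by (cases "x = 0") simp_all

text \<open>By associativity of the form, multiplication by \<open>c\<close> is
  self-adjoint.\<close>

lemma tf_eigen_orth:
  assumes "c \<odot> a = r *\<^sub>R a" "c \<odot> b = s *\<^sub>R b" "r \<noteq> s"
  shows "tf a b = 0"
proof -
  have "r * tf a b = tf (a \<odot> c) b" using assms by (simp add: comm[of a] tf_linear)
  also have "\<dots> = s * tf a b" using assms by (simp add: tf_assoc tf_linear)
  finally show ?thesis using assms(3) by simp
qed

text \<open>The Peirce spaces are orthogonal, so multiplication by \<open>c\<close> is a diagonal
  form with weights 1, 1/2 and 0, in particular positive semidefinite.\<close>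

lemma tf_idempotent_form:
  assumes "c \<odot> c = c"
  shows "tf (c \<odot> w) w = tf (pe1 c w) (pe1 c w) + tf (peh c w) (peh c w) / 2"
proof -
  note p = peirce1[OF assms] peirceh[OF assms] peirce0[OF assms]
  have o: "tf (pe1 c w) (peh c w) = 0" "tf (pe1 c w) (pe0 c w) = 0" "tf (peh c w) (pe0 c w) = 0"
    using tf_eigen_orth[of c "pe1 c w" 1 "peh c w" "1/2"] tf_eigen_orth[of c "pe1 c w" 1 "pe0 c w" 0]
      tf_eigen_orth[of c "peh c w" "1/2" "pe0 c w" 0] p by auto
  have "tf (c \<odot> w) w = tf (pe1 c w + (1/2) *\<^sub>R peh c w) (pe1 c w + peh c w + pe0 c w)"
    using peirce_jp peirce_sum by metis
  then show ?thesis by (simp add: tf_linear o tf_commute[of "peh c w" "pe1 c w"])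
qed

lemma tf_idempotent_nonneg: "c \<odot> c = c \<Longrightarrow> tf (c \<odot> w) w \<ge> 0"
  by (simp add: tf_idempotent_form tf_nonneg)

text \<open>The equality case of positivity; it upgrades trace orthogonality to a vanishing
  product.\<close>

lemma tf_idempotent_zero:
  assumes "c \<odot> c = c" "tf (c \<odot> w) w = 0"
  shows "c \<odot> w = 0"
proof -
  have "tf (pe1 c w) (pe1 c w) = 0" "tf (peh c w) (peh c w) = 0"
    using assms tf_idempotent_form[OF assms(1), of w] tf_nonneg[of "pe1 c w"] tf_nonneg[of "peh c w"]
    by linarith+
  then show ?thesis using peirce_jp[of c w] by (simp add: tf_eq_0)
qed

section \<open>Multiplication rules of the Peirce spaces\<close>

text \<open>The linearized identity gives (1 - 2r)(c(ab) - s ab) = 0, and the first factor vanishes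
  only for the half space.\<close>

lemma peirce_mult:
  assumes "c \<odot> c = c" "c \<odot> a = r *\<^sub>R a" "c \<odot> b = s *\<^sub>R b" "r \<noteq> 1/2"
  shows "c \<odot> (a \<odot> b) = s *\<^sub>R (a \<odot> b)"
proof -
  have "c \<odot> (a \<odot> b) + (r * s) *\<^sub>R (a \<odot> b) + (r * s) *\<^sub>R (a \<odot> b)
      = s *\<^sub>R (a \<odot> b) + r *\<^sub>R (c \<odot> (a \<odot> b)) + r *\<^sub>R (c \<odot> (a \<odot> b))"
    using jordan_linearized[of c c a b] assms by (simp add: comm[of a c] jp_linear mult.commute)
  moreover have "(1 - 2 * r) *\<^sub>R (c \<odot> (a \<odot> b) - s *\<^sub>R (a \<odot> b))
      = c \<odot> (a \<odot> b) + (r * s) *\<^sub>R (a \<odot> b) + (r * s) *\<^sub>R (a \<odot> b)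
      - (s *\<^sub>R (a \<odot> b) + r *\<^sub>R (c \<odot> (a \<odot> b)) + r *\<^sub>R (c \<odot> (a \<odot> b)))"
    by (rule eq_by_inner) (simp add: inner_simps algebra_simps)
  ultimately have "(1 - 2 * r) *\<^sub>R (c \<odot> (a \<odot> b) - s *\<^sub>R (a \<odot> b)) = 0"
    by simp
  then show ?thesis using assms(4) by simp
qed

text \<open>By \<open>peirce_mult\<close> used from either side, the product lies in the eigenspaces
  of both 0 and 1.\<close>

lemma peirce_mult_10:
  assumes "c \<odot> c = c" "c \<odot> a = a" "c \<odot> b = 0"
  shows "a \<odot> b = 0"
  using peirce_mult[of c a 1 b 0] peirce_mult[of c b 0 a 1] assms by (simp add: comm)

text \<open>Says that products of half-space elements have no half-space component.\<close>

lemma peirce_mult_hh: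
  assumes "c \<odot> c = c" "c \<odot> a = (1/2) *\<^sub>R a" "c \<odot> b = (1/2) *\<^sub>R b"
  shows "c \<odot> (c \<odot> (a \<odot> b)) = c \<odot> (a \<odot> b)"
  using jordan_linearized[of c a b c] assms
  by (simp add: comm[of a c] comm[of b c] comm[of b a] comm[of "a \<odot> b" c] jp_linear
      scaleR_add_left[symmetric])

text \<open>Equivalently, \<open>U\<close> of an element of the 0-space vanishes on the half
  space.\<close>

lemma peirce_0h_square:
  assumes "c \<odot> c = c" "c \<odot> a = 0" "c \<odot> v = (1/2) *\<^sub>R v"
  shows "(a \<odot> a) \<odot> v = 2 *\<^sub>R (a \<odot> (a \<odot> v))"
proof -
  have av: "c \<odot> (a \<odot> v) = (1/2) *\<^sub>R (a \<odot> v)" "c \<odot> (a \<odot> a) = 0"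
    using peirce_mult[of c a 0 v "1/2"] peirce_mult[of c a 0 a 0] assms by auto
  have "(1/2) *\<^sub>R ((a \<odot> a) \<odot> v) = a \<odot> (a \<odot> v)"
    using jordan_linearized[of a a v c] assms av
    by (simp add: comm[of a c] comm[of v c] comm[of v a] comm[of "a \<odot> a" c] comm[of "a \<odot> v" c]
        jp_linear scaleR_add_left[symmetric])
  then have "2 *\<^sub>R ((1/2) *\<^sub>R ((a \<odot> a) \<odot> v)) = 2 *\<^sub>R (a \<odot> (a \<odot> v))" by simp
  then show ?thesis by simp
qed

section \<open>The cone of squares\<close>

text \<open>One argument gives both facts. A square w^2 pairs with \<open>c\<close> to
  \<open>tf (c \<odot> w) w\<close>, which is nonnegative. Conversely, pairing \<open>x\<close> with
  its own spectral idempotents shows its eigenvalues to be nonnegative, and their square roots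
  present \<open>x\<close> as a square.\<close>

lemma Apos_iff: "x \<in> Apos jp \<longleftrightarrow> (\<forall>c. c \<odot> c = c \<longrightarrow> tf x c \<ge> 0)"
  and spectral_nonneg: "x \<in> Apos jp \<Longrightarrow> \<exists>C f. osys C \<and> 0 \<notin> C \<and> sum id C = u \<and>
    (\<forall>c\<in>C. f c \<ge> 0) \<and> x = (\<Sum>c\<in>C. f c *\<^sub>R c)"
proof -
  have 1: "tf x c \<ge> 0" if "x \<in> Apos jp" "c \<odot> c = c" for x c
  proof -
    obtain w where "x = w \<odot> w" using \<open>x \<in> Apos jp\<close> by (auto simp: Apos_def)
    then have "tf x c = tf w (c \<odot> w)" by (simp add: tf_assoc comm[of w c])
    also have "\<dots> = tf (c \<odot> w) w" by (rule tf_commute)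
    finally have "tf x c = tf (c \<odot> w) w" .
    then show ?thesis using tf_idempotent_nonneg[OF that(2), of w] by simp
  qed
  have 2: "\<exists>C f. osys C \<and> 0 \<notin> C \<and> sum id C = u \<and>
    (\<forall>c\<in>C. f c \<ge> 0) \<and> x = (\<Sum>c\<in>C. f c *\<^sub>R c)" if x: "\<forall>c. c \<odot> c = c \<longrightarrow> tf x c \<ge> 0" for x
  proof -
    obtain C f where C: "osys C" "0 \<notin> C" "sum id C = u" "\<And>c. c \<in> C \<Longrightarrow> x \<odot> c = f c *\<^sub>R c"
      "x = (\<Sum>c\<in>C. f c *\<^sub>R c)"
      by (rule spectral[of x]) blast
    have "f c \<ge> 0" if "c \<in> C" for c
    proof -
      have cc: "c \<odot> c = c" using osysD(2)[OF C(1) that] .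
      have c0: "c \<noteq> 0" using that C(2) by auto
      have "tf x c = tf (x \<odot> c) c" using cc by (simp add: tf_assoc)
      then have "f c * tf c c \<ge> 0" using x[rule_format, OF cc] C(4)[OF that] by (simp add: tf_linear)
      then show ?thesis using tf_idempotent[OF cc c0] by (simp add: zero_le_mult_iff)
    qed
    then have "\<forall>c\<in>C. f c \<ge> 0" ..
    then show ?thesis using C(1-3,5) by (intro exI[of _ C] exI[of _ f] conjI) assumption+
  qed
  have 3: "x \<in> Apos jp" if x: "\<forall>c. c \<odot> c = c \<longrightarrow> tf x c \<ge> 0" for x
  proof -
    obtain C f where C: "osys C" "\<forall>c\<in>C. f c \<ge> 0" "x = (\<Sum>c\<in>C. f c *\<^sub>R c)"
      using 2[OF x] by (elim exE conjE) blast
    define w where "w = (\<Sum>c\<in>C. sqrt (f c) *\<^sub>R c)"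
    have "w \<odot> w = (\<Sum>c\<in>C. (sqrt (f c) * sqrt (f c)) *\<^sub>R c)"
      unfolding w_def by (rule osys_mult[OF C(1)])
    also have "\<dots> = x" unfolding C(3) using C(2) by (intro sum.cong) auto
    finally show ?thesis unfolding Apos_def by blast
  qed
  show "x \<in> Apos jp \<longleftrightarrow> (\<forall>c. c \<odot> c = c \<longrightarrow> tf x c \<ge> 0)"
    by (intro iffI 3) (auto intro: 1)
  assume "x \<in> Apos jp"
  then show "\<exists>C f. osys C \<and> 0 \<notin> C \<and> sum id C = u \<and>
    (\<forall>c\<in>C. f c \<ge> 0) \<and> x = (\<Sum>c\<in>C. f c *\<^sub>R c)"
    by (intro 2 allI impI 1)
qed

lemma Apos_square: "x \<odot> x \<in> Apos jp"
  by (auto simp: Apos_def)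

lemma Apos_idempotent: "c \<odot> c = c \<Longrightarrow> c \<in> Apos jp"
  using Apos_square[of c] by simp

lemma Apos_unit: "u \<in> Apos jp"
  by (simp add: Apos_idempotent)

lemma Apos_0 [simp]: "0 \<in> Apos jp"
  by (simp add: Apos_iff)

lemma Apos_add: "x \<in> Apos jp \<Longrightarrow> y \<in> Apos jp \<Longrightarrow> x + y \<in> Apos jp"
  by (simp add: Apos_iff tf_linear)

lemma Apos_scale: "x \<in> Apos jp \<Longrightarrow> r \<ge> 0 \<Longrightarrow> r *\<^sub>R x \<in> Apos jp"
  by (simp add: Apos_iff tf_linear)

lemma Apos_sum: "(\<And>i. i \<in> I \<Longrightarrow> f i \<in> Apos jp) \<Longrightarrow> (\<Sum>i\<in>I. f i) \<in> Apos jp"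
  by (induction I rule: infinite_finite_induct) (simp_all add: Apos_add)

lemma Apos_osys: "osys C \<Longrightarrow> (\<And>c. c \<in> C \<Longrightarrow> f c \<ge> 0) \<Longrightarrow> (\<Sum>c\<in>C. f c *\<^sub>R c) \<in> Apos jp"
  by (intro Apos_sum Apos_scale Apos_idempotent) (auto simp: osysD(2))

lemma Apos_pointed: "x \<in> Apos jp \<Longrightarrow> - x \<in> Apos jp \<Longrightarrow> x = 0"
proof -
  assume "x \<in> Apos jp" "- x \<in> Apos jp"
  then obtain v w where vw: "x = v \<odot> v" "- x = w \<odot> w" by (auto simp: Apos_def)
  then have "v \<odot> v + w \<odot> w = 0" by (metis add.right_inverse)
  then have "v = 0" by (rule formally_real)
  then show "x = 0" using vw by simp
qed

lemma bilinear_tf: "bilinear tf"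
  unfolding bilinear_def by (auto intro!: linearI simp: tf_linear)

lemma closed_Apos: "closed (Apos jp)"
proof -
  have "Apos jp = (\<Inter>c\<in>{c. c \<odot> c = c}. {x. 0 \<le> tf x c})" by (auto simp: Apos_iff)
  moreover have "continuous_on UNIV (\<lambda>x. tf x c)" for c
    using bilinear_tf by (intro linear_continuous_on) (simp add: bilinear_def linear_conv_bounded_linear)
  ultimately show ?thesis by (auto intro!: closed_INT closed_Collect_le continuous_intros)
qed

lemma unit_nonzero: "u \<noteq> 0"
proof
  assume "u = 0"
  then have "x = 0" for x :: 'a using unit_left[of x] by simp
  then show False using nonzero_Basis nonempty_Basis by (metis ex_in_conv)
qed

text \<open>Since \<open>tf c c >= 1\<close>, the square of each eigenvalue of \<open>x\<close> is
  at most \<open>tf x x\<close>, hence at most B |x|^2. For |x| < 1 / sqrt B every eigenvalue of u +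
  x is therefore positive.\<close>

lemma unit_interior_ball: "\<exists>e>0. \<forall>x. norm x < e \<longrightarrow> u + x \<in> Apos jp"
proof -
  obtain B where B: "B > 0" "\<And>x y. norm (tf x y) \<le> B * norm x * norm y"
    using bilinear_bounded_pos[OF bilinear_tf] by blast
  have "u + x \<in> Apos jp" if "norm x < 1 / sqrt B" for x
  proof -
    obtain C f where C: "osys C" "0 \<notin> C" "sum id C = u" "x = (\<Sum>c\<in>C. f c *\<^sub>R c)"
      by (rule spectral[of x]) blast
    have "norm x * norm x < (1 / sqrt B) * (1 / sqrt B)"
      using that by (intro mult_strict_mono') auto
    then have "B * norm x * norm x < 1" using B(1) by (simp add: field_simps)
    then have tx: "tf x x < 1" using B(2)[of x x] by simp
    have "1 + f c \<ge> 0" if c: "c \<in> C" for c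
    proof -
      have t: "tf d d \<ge> 1" if "d \<in> C" for d
      proof -
        have "d \<noteq> 0" using that C(2) by auto
        then show ?thesis using tf_idempotent[OF osysD(2)[OF C(1) that]] by simp
      qed
      have "f c * f c \<le> f c * f c * tf c c" using mult_left_mono[OF t[OF c], of "f c * f c"] by simp
      also have "\<dots> \<le> (\<Sum>c\<in>C. f c * f c * tf c c)"
      proof (rule member_le_sum[OF c _ osysD(1)[OF C(1)]])
        fix d assume "d \<in> C - {c}"
        then have "0 \<le> tf d d" using t[of d] by simp
        then show "0 \<le> f d * f d * tf d d" by (rule mult_nonneg_nonneg[OF zero_le_square])
      qed
      also have "\<dots> = tf x x" unfolding C(4) by (rule tf_osys[OF C(1), symmetric])
      finally have "(f c)\<^sup>2 < 1\<^sup>2" using tx by (simp add: power2_eq_square)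
      then have "\<bar>f c\<bar> < 1" by (metis abs_square_less_1 one_power2)
      then show ?thesis by simp
    qed
    then have "(\<Sum>c\<in>C. (1 + f c) *\<^sub>R c) \<in> Apos jp" by (intro Apos_osys[OF C(1)])
    moreover have "(\<Sum>c\<in>C. (1 + f c) *\<^sub>R c) = u + x"
      unfolding C(4) C(3)[symmetric] by (simp add: scaleR_add_left sum.distrib)
    ultimately show ?thesis by simp
  qed
  then show ?thesis using B(1) by (intro exI[of _ "1 / sqrt B"]) auto
qed

text \<open>\<open>u\<close> is an order unit; most later arguments about the interior can then be
  made in terms of the order alone.\<close>

lemma Aint_iff: "x \<in> Aint jp \<longleftrightarrow> (\<exists>e>0. x - e *\<^sub>R u \<in> Apos jp)"
proof
  assume "x \<in> Aint jp"
  then obtain d where d: "d > 0" "ball x d \<subseteq> Apos jp"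
    unfolding Aint_def mem_interior by blast
  define e where "e = d / (2 * norm u)"
  have "norm (e *\<^sub>R u) < d" using d(1) unit_nonzero by (simp add: e_def)
  then have "x - e *\<^sub>R u \<in> ball x d" by (simp add: dist_norm)
  then show "\<exists>e>0. x - e *\<^sub>R u \<in> Apos jp"
    using d unit_nonzero by (intro exI[of _ e]) (auto simp: e_def)
next
  assume "\<exists>e>0. x - e *\<^sub>R u \<in> Apos jp"
  then obtain e where e: "e > 0" "x - e *\<^sub>R u \<in> Apos jp" by blast
  obtain d where d: "d > 0" "\<And>x. norm x < d \<Longrightarrow> u + x \<in> Apos jp" using unit_interior_ball by blast
  have "ball x (e * d) \<subseteq> Apos jp"
  proof
    fix y assume "y \<in> ball x (e * d)"
    then have "norm (y - x) < e * d" by (simp add: dist_norm norm_minus_commute)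
    then have "norm (y - x) / e < d" using e(1) by (simp add: pos_divide_less_eq mult.commute)
    then have "norm ((1 / e) *\<^sub>R (y - x)) < d" using e(1) by (simp only: norm_scaleR) simp
    then have "e *\<^sub>R (u + (1 / e) *\<^sub>R (y - x)) \<in> Apos jp" using d(2) e(1) by (intro Apos_scale) auto
    moreover have "(x - e *\<^sub>R u) + e *\<^sub>R (u + (1 / e) *\<^sub>R (y - x)) = y"
      using e(1) by (simp add: algebra_simps)
    ultimately show "y \<in> Apos jp" using Apos_add[OF e(2)] by metis
  qed
  then show "x \<in> Aint jp" unfolding Aint_def mem_interior using e(1) d(1) by (meson mult_pos_pos)
qed

lemma Aint_Apos: "x \<in> Aint jp \<Longrightarrow> x \<in> Apos jp"
  using interior_subset unfolding Aint_def by blast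

lemma Aint_nonzero: "x \<in> Aint jp \<Longrightarrow> x \<noteq> 0"
proof
  assume "x \<in> Aint jp" "x = 0"
  then obtain e where "e > 0" "- (e *\<^sub>R u) \<in> Apos jp" by (auto simp: Aint_iff)
  then have "e *\<^sub>R u = 0" using Apos_pointed[of "e *\<^sub>R u"] Apos_scale[OF Apos_unit, of e] by simp
  then show False using \<open>e > 0\<close> unit_nonzero by simp
qed

lemma Aint_add: "x \<in> Aint jp \<Longrightarrow> y \<in> Apos jp \<Longrightarrow> x + y \<in> Aint jp"
  unfolding Aint_iff by (metis Apos_add add_diff_eq add.commute)

lemma Aint_scale: "x \<in> Aint jp \<Longrightarrow> r > 0 \<Longrightarrow> r *\<^sub>R x \<in> Aint jp"
proof -
  assume "x \<in> Aint jp" and r: "r > 0"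
  then obtain e where "e > 0" "x - e *\<^sub>R u \<in> Apos jp" by (auto simp: Aint_iff)
  then have "r * e > 0" "r *\<^sub>R x - (r * e) *\<^sub>R u \<in> Apos jp"
    using Apos_scale[of "x - e *\<^sub>R u" r] r by (auto simp: algebra_simps)
  then show ?thesis unfolding Aint_iff by blast
qed

lemma Aint_unit: "u \<in> Aint jp"
  unfolding Aint_iff by (rule exI[of _ 1]) simp

lemma Aint_osys:
  assumes "osys C" "sum id C = u" "\<And>c. c \<in> C \<Longrightarrow> f c > 0"
  shows "(\<Sum>c\<in>C. f c *\<^sub>R c) \<in> Aint jp"
proof -
  have ne: "C \<noteq> {}" using assms(2) unit_nonzero by auto
  have fin: "finite C" using osysD(1)[OF assms(1)] .
  define e where "e = Min (f ` C)"
  have e: "e > 0" "\<And>c. c \<in> C \<Longrightarrow> f c - e \<ge> 0" using ne fin assms(3) by (auto simp: e_def)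
  have "(\<Sum>c\<in>C. (f c - e) *\<^sub>R c) \<in> Apos jp" using e by (intro Apos_osys assms(1))
  moreover have "(\<Sum>c\<in>C. (f c - e) *\<^sub>R c) = (\<Sum>c\<in>C. f c *\<^sub>R c) - e *\<^sub>R u"
    unfolding assms(2)[symmetric] by (simp add: scaleR_diff_left sum_subtractf scaleR_sum_right)
  ultimately show ?thesis unfolding Aint_iff using e(1) by metis
qed

lemma spectral_Aint:
  assumes "x \<in> Aint jp"
  obtains C f where "osys C" "sum id C = u" "\<And>c. c \<in> C \<Longrightarrow> f c > 0" "x = (\<Sum>c\<in>C. f c *\<^sub>R c)"
proof -
  obtain e where e: "e > 0" "x - e *\<^sub>R u \<in> Apos jp" using assms by (auto simp: Aint_iff)
  obtain C f where C: "osys C" "sum id C = u" "\<forall>c\<in>C. f c \<ge> 0" "x - e *\<^sub>R u = (\<Sum>c\<in>C. f c *\<^sub>R c)"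
    using spectral_nonneg[OF e(2)] by (elim exE conjE) blast
  have "x = (\<Sum>c\<in>C. f c *\<^sub>R c) + e *\<^sub>R u" by (simp flip: C(4))
  also have "\<dots> = (\<Sum>c\<in>C. (f c + e) *\<^sub>R c)"
    unfolding C(2)[symmetric] by (simp add: scaleR_add_left sum.distrib scaleR_sum_right)
  finally show thesis
    using e(1) C(3) by (intro that[OF C(1,2), of "\<lambda>c. f c + e"]) (auto intro: add_nonneg_pos)
qed

section \<open>Positivity of the quadratic maps\<close>

lemma pe_components:
  assumes "c \<odot> a1 = a1" "c \<odot> ah = (1/2) *\<^sub>R ah" "c \<odot> a0 = 0"
  shows "pe1 c (a1 + ah + a0) = a1" "peh c (a1 + ah + a0) = ah" "pe0 c (a1 + ah + a0) = a0"
  by (rule eq_by_inner, simp add: pe1_def peh_def pe0_def jp_linear assms inner_simps field_simps)+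

lemma peirce_unique:
  assumes "c \<odot> a1 = a1" "c \<odot> ah = (1/2) *\<^sub>R ah" "c \<odot> a0 = 0"
    "c \<odot> b1 = b1" "c \<odot> bh = (1/2) *\<^sub>R bh" "c \<odot> b0 = 0" "a1 + ah + a0 = b1 + bh + b0"
  shows "a1 = b1" "ah = bh" "a0 = b0"
  using pe_components[OF assms(1-3)] pe_components[OF assms(4-6)] assms(7) by simp_all

abbreviation U :: "'a \<Rightarrow> 'a \<Rightarrow> 'a" where "U \<equiv> Uop jp"

lemma linear_U: "linear (U a)"
  by (intro linearI) (simp_all add: Uop_def jp_linear algebra_simps)

text \<open>\<open>a\<close> and its square annihilate the 1-space, \<open>U a\<close> vanishes on
  the half space by \<open>peirce_0h_square\<close> so that only the mixed term survives there, and
  \<open>c\<close> annihilates the 0-space.\<close>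

lemma U_peirce:
  assumes c: "c \<odot> c = c" and a: "c \<odot> a = 0"
  shows "U (a + r *\<^sub>R c) v = r\<^sup>2 *\<^sub>R pe1 c v + (2 * r) *\<^sub>R (a \<odot> peh c v) + U a (pe0 c v)"
proof -
  note p = peirce1[OF c] peirceh[OF c] peirce0[OF c]
  define b where "b = a + r *\<^sub>R c"
  have bb: "b \<odot> b = a \<odot> a + r\<^sup>2 *\<^sub>R c"
    by (simp add: b_def jp_linear a comm[of a c] c power2_eq_square)
  have aa: "c \<odot> (a \<odot> a) = 0" using peirce_mult[of c a 0 a 0] a c by simp
  have 1: "U b (pe1 c v) = r\<^sup>2 *\<^sub>R pe1 c v"
  proof -
    have "a \<odot> pe1 c v = 0" "(a \<odot> a) \<odot> pe1 c v = 0"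
      using peirce_mult_10[OF c p(1) a, of v] peirce_mult_10[OF c p(1) aa, of v] by (simp_all add: comm)
    then show ?thesis unfolding Uop_def bb
      by - (rule eq_by_inner, simp add: b_def jp_linear p power2_eq_square inner_simps algebra_simps)
  qed
  have h: "U b (peh c v) = (2 * r) *\<^sub>R (a \<odot> peh c v)"
  proof -
    have "c \<odot> (a \<odot> peh c v) = (1/2) *\<^sub>R (a \<odot> peh c v)"
      using peirce_mult[of c a 0 "peh c v" "1/2"] a c p by simp
    moreover have "(a \<odot> a) \<odot> peh c v = 2 *\<^sub>R (a \<odot> (a \<odot> peh c v))"
      using peirce_0h_square[OF c a p(2)] .
    ultimately show ?thesis unfolding Uop_def bb
      by - (rule eq_by_inner, simp add: b_def jp_linear p power2_eq_square inner_simps algebra_simps)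
  qed
  have 0: "U b (pe0 c v) = U a (pe0 c v)"
  proof -
    have "c \<odot> (a \<odot> pe0 c v) = 0"
      using peirce_mult[of c a 0 "pe0 c v" 0] a c p by simp
    then show ?thesis unfolding Uop_def bb by (simp add: b_def jp_linear p)
  qed
  have "U b v = U b (pe1 c v + peh c v + pe0 c v)" by (simp add: peirce_sum)
  also have "\<dots> = U b (pe1 c v) + U b (peh c v) + U b (pe0 c v)"
    by (simp add: linear_add[OF linear_U])
  finally show ?thesis unfolding 1 h 0 unfolding b_def .
qed

lemma U_peirce_simple:
  assumes c: "c \<odot> c = c"
  shows "U ((u - c) + r *\<^sub>R c) v = r\<^sup>2 *\<^sub>R pe1 c v + r *\<^sub>R peh c v + pe0 c v"
proof -
  have "c \<odot> (u - c) = 0" using c by (simp add: jp_linear)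
  note * = U_peirce[OF c this, of r v]
  have "(2 * r) *\<^sub>R ((u - c) \<odot> peh c v) = r *\<^sub>R peh c v"
    by (rule eq_by_inner) (simp add: jp_linear peirceh[OF c] inner_simps)
  moreover have "U (u - c) (pe0 c v) = pe0 c v"
    by (simp add: Uop_def jp_linear peirce0[OF c] c scaleR_2)
  ultimately show ?thesis using * by simp
qed

text \<open>Splits off the eigenvalue \<open>r\<close> of \<open>c\<close>:
  \<open>U_peirce_simple\<close> scales the three Peirce components of \<open>v\<close> by r^2, r
  and 1, and the eigenvalue left at \<open>c\<close> is 1.\<close>

lemma U_factor:
  assumes c: "c \<odot> c = c" and a: "c \<odot> a = 0"
  shows "U (a + r *\<^sub>R c) v = U (a + c) (U ((u - c) + r *\<^sub>R c) v)"
proof -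
  let ?w = "r\<^sup>2 *\<^sub>R pe1 c v + r *\<^sub>R peh c v + pe0 c v"
  note p = peirce1[OF c, of v] peirceh[OF c, of v] peirce0[OF c, of v]
  have w: "pe1 c ?w = r\<^sup>2 *\<^sub>R pe1 c v" "peh c ?w = r *\<^sub>R peh c v" "pe0 c ?w = pe0 c v"
    using p by (intro pe_components; simp add: jp_linear)+
  show ?thesis
    using U_peirce[OF c a, of r v] U_peirce[OF c a, of 1 ?w]
    unfolding U_peirce_simple[OF c] w by (simp add: jp_linear)
qed

text \<open>A spectral idempotent \<open>c\<close> of \<open>v\<close> with nonzero eigenvalue again
  lies in the 1-space of \<open>d\<close>, so d = c + (d - c) is an orthogonal splitting;
  primitivity forces c = d.\<close>

lemma primitive_scalar:
  assumes d: "primitive_idem jp d" and v: "d \<odot> v = v"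
  obtains r where "v = r *\<^sub>R d"
proof -
  have dd: "d \<odot> d = d" using d by (simp add: primitive_idem_def idem_def)
  obtain C f where C: "osys C" "0 \<notin> C" "sum id C = u" "C \<subseteq> alg v"
    "\<And>c. c \<in> C \<Longrightarrow> v \<odot> c = f c *\<^sub>R c" "v = (\<Sum>c\<in>C. f c *\<^sub>R c)"
    by (rule spectral[of v]) blast
  \<comment> \<open>The extra factor \<open>v\<close> is needed because \<open>d\<close> need not
    fix the zeroth power \<open>u\<close>.\<close>
  have pow: "d \<odot> (v \<odot> pow v n) = v \<odot> pow v n" for n
  proof (induction n)
    case (Suc n)
    show ?case using peirce_mult[of d v 1 "pow v (Suc n)" 1] dd v Suc by (simp add: pow_Suc)
  qed (simp add: v)
  have fixed: "d \<odot> (v \<odot> w) - v \<odot> w = 0" if "w \<in> alg v" for w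
    by (rule linear_zero_on_span[OF _ _ that[unfolded alg_def]])
       (use pow in \<open>auto intro!: linearI simp: jp_linear algebra_simps\<close>)
  have eq: "c = d" if c: "c \<in> C" "f c \<noteq> 0" for c
  proof (rule ccontr)
    assume "c \<noteq> d"
    have cc: "c \<odot> c = c" using osysD(2)[OF C(1) c(1)] .
    have "c \<in> alg v" using C(4) c(1) by blast
    then have "d \<odot> (v \<odot> c) - v \<odot> c = 0" by (rule fixed)
    then have "f c *\<^sub>R (d \<odot> c - c) = 0"
      using C(5)[OF c(1)] by (simp add: jp_linear scaleR_diff_right)
    then have dc: "d \<odot> c = c" using c(2) by simp
    have c0: "c \<noteq> 0" using C(2) c(1) by auto
    have "idem jp c \<and> idem jp (d - c) \<and> c \<noteq> 0 \<and> d - c \<noteq> 0 \<and> c \<odot> (d - c) = 0 \<and> d = c + (d - c)"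
      using cc dc dd c0 \<open>c \<noteq> d\<close> by (simp add: idem_def jp_linear comm[of c d])
    then show False using d unfolding primitive_idem_def by blast
  qed
  have "v = (\<Sum>c\<in>C. if c = d then f d *\<^sub>R d else 0)"
    unfolding C(6) by (intro sum.cong refl) (use eq in force)
  also have "\<dots> = (if d \<in> C then f d else 0) *\<^sub>R d" using osysD(1)[OF C(1)] by simp
  finally show thesis by (rule that)
qed

lemma tf_idempotents_nonneg: "c \<odot> c = c \<Longrightarrow> d \<odot> d = d \<Longrightarrow> tf c d \<ge> 0"
  using tf_idempotent_nonneg[of c d] by (simp add: tf_assoc)

text \<open>With \<open>U\<^sub>d c = s d\<close>, the element \<open>e = U\<^sub>b d\<close> satisfies \<open>e\<^sup>2 = (r\<^sup>2 s + 1 - s) e\<close>, so it is a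
  nonnegative multiple of a square.\<close>
lemma U_simple_primitive:
  assumes c: "c \<odot> c = c" and d: "primitive_idem jp d"
  shows "U ((u - c) + r *\<^sub>R c) d \<in> Apos jp"
proof -
  have dd: "d \<odot> d = d" "d \<noteq> 0" using d by (auto simp: primitive_idem_def idem_def)
  obtain s where s: "pe1 d c = s *\<^sub>R d"
    using primitive_scalar[OF d peirce1[OF dd(1), of c]] by blast
  define d1 dh d0 where "d1 = pe1 c d" and "dh = peh c d" and "d0 = pe0 c d"
  have dsum: "d = d1 + dh + d0" by (simp add: d1_def dh_def d0_def peirce_sum)
  have p: "c \<odot> d1 = d1" "c \<odot> dh = (1/2) *\<^sub>R dh" "c \<odot> d0 = 0"
    by (simp_all add: d1_def dh_def d0_def peirce1 peirceh peirce0 c)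
  \<comment> \<open>By \<open>peirce_mult_hh\<close> these are the 1- and 0-components of the square
    of \<open>dh\<close>.\<close>
  define g1 g0 where "g1 = c \<odot> (dh \<odot> dh)" and "g0 = dh \<odot> dh - g1"
  have g: "c \<odot> g1 = g1" "c \<odot> g0 = 0" "dh \<odot> dh = g1 + g0"
    using peirce_mult_hh[OF c p(2) p(2)] by (simp_all add: g1_def g0_def jp_linear)
  have m: "c \<odot> (d1 \<odot> d1) = d1 \<odot> d1" "c \<odot> (d0 \<odot> d0) = 0" "d1 \<odot> d0 = 0"
    "c \<odot> (d1 \<odot> dh) = (1/2) *\<^sub>R (d1 \<odot> dh)" "c \<odot> (d0 \<odot> dh) = (1/2) *\<^sub>R (d0 \<odot> dh)"
    using peirce_mult[OF c, of d1 1 d1 1] peirce_mult[OF c, of d0 0 d0 0] peirce_mult_10[OF c p(1,3)]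
      peirce_mult[OF c, of d1 1 dh "1/2"] peirce_mult[OF c, of d0 0 dh "1/2"] p by simp_all
  note cm = comm[of dh d1] comm[of dh d0] comm[of d0 d1]
  have sq: "(d1 \<odot> d1 + g1) + (2 *\<^sub>R (d1 \<odot> dh) + 2 *\<^sub>R (d0 \<odot> dh)) + (d0 \<odot> d0 + g0) = d1 + dh + d0"
  proof -
    have "d \<odot> d = (d1 \<odot> d1 + g1) + (2 *\<^sub>R (d1 \<odot> dh) + 2 *\<^sub>R (d0 \<odot> dh)) + (d0 \<odot> d0 + g0)"
      unfolding dsum by (rule eq_by_inner) (simp add: jp_linear cm m g(3) inner_simps)
    then show ?thesis using dd(1) dsum by simp
  qed
  have "c \<odot> (d1 \<odot> d1 + g1) = d1 \<odot> d1 + g1" "c \<odot> (d0 \<odot> d0 + g0) = 0"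
    "c \<odot> (2 *\<^sub>R (d1 \<odot> dh) + 2 *\<^sub>R (d0 \<odot> dh)) = (1/2) *\<^sub>R (2 *\<^sub>R (d1 \<odot> dh) + 2 *\<^sub>R (d0 \<odot> dh))"
    by (simp_all add: jp_linear m g algebra_simps)
  note A = peirce_unique[OF this(1) this(3) this(2) p sq]
  have dc: "d \<odot> c = d1 + (1/2) *\<^sub>R dh"
    using peirce_jp[of c d] by (simp add: comm d1_def dh_def)
  have E: "(2 *\<^sub>R (d1 \<odot> d1) + g1 - d1) + (3 *\<^sub>R (d1 \<odot> dh) + d0 \<odot> dh - (1/2) *\<^sub>R dh) + g0
      = s *\<^sub>R d1 + s *\<^sub>R dh + s *\<^sub>R d0"
  proof -
    have "pe1 d c = 2 *\<^sub>R (d \<odot> (d1 + (1/2) *\<^sub>R dh)) - (d1 + (1/2) *\<^sub>R dh)"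
      unfolding pe1_def dc ..
    also have "\<dots> = (2 *\<^sub>R (d1 \<odot> d1) + g1 - d1) + (3 *\<^sub>R (d1 \<odot> dh) + d0 \<odot> dh - (1/2) *\<^sub>R dh) + g0"
      unfolding dsum by (rule eq_by_inner) (simp add: jp_linear cm m g(3) inner_simps field_simps)
    finally show ?thesis using s dsum by (simp add: scaleR_add_right)
  qed
  have "c \<odot> (2 *\<^sub>R (d1 \<odot> d1) + g1 - d1) = 2 *\<^sub>R (d1 \<odot> d1) + g1 - d1"
    "c \<odot> (3 *\<^sub>R (d1 \<odot> dh) + d0 \<odot> dh - (1/2) *\<^sub>R dh)
      = (1/2) *\<^sub>R (3 *\<^sub>R (d1 \<odot> dh) + d0 \<odot> dh - (1/2) *\<^sub>R dh)"
    "c \<odot> (s *\<^sub>R d1) = s *\<^sub>R d1" "c \<odot> (s *\<^sub>R dh) = (1/2) *\<^sub>R (s *\<^sub>R dh)" "c \<odot> (s *\<^sub>R d0) = 0"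
    by (simp_all add: jp_linear m g p algebra_simps)
  note B = peirce_unique[OF this(1,2) g(2) this(3-5) E]
  \<comment> \<open>The Peirce components with respect to \<open>c\<close> of d^2 = d and of
    \<open>pe1 d c = s *\<^sub>R d\<close> form a linear system for the products. Solving it makes
    each unknown a multiple of \<open>d1\<close>, \<open>dh\<close> or \<open>d0\<close>.\<close>
  have comp: "d1 \<odot> d1 \<bullet> i + g1 \<bullet> i = d1 \<bullet> i" "2 * (d1 \<odot> dh \<bullet> i) + 2 * (d0 \<odot> dh \<bullet> i) = dh \<bullet> i"
    "d0 \<odot> d0 \<bullet> i + g0 \<bullet> i = d0 \<bullet> i" "2 * (d1 \<odot> d1 \<bullet> i) + g1 \<bullet> i - d1 \<bullet> i = s * (d1 \<bullet> i)"
    "3 * (d1 \<odot> dh \<bullet> i) + d0 \<odot> dh \<bullet> i - (dh \<bullet> i) / 2 = s * (dh \<bullet> i)" "g0 \<bullet> i = s * (d0 \<bullet> i)" for i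
    using A[THEN arg_cong, of "\<lambda>v. v \<bullet> i"] B[THEN arg_cong, of "\<lambda>v. v \<bullet> i"]
    by (simp_all add: inner_simps)
  have sol: "d1 \<odot> d1 \<bullet> i = s * (d1 \<bullet> i)" "g1 \<bullet> i = d1 \<bullet> i - s * (d1 \<bullet> i)" "g0 \<bullet> i = s * (d0 \<bullet> i)"
    "d0 \<odot> d0 \<bullet> i = d0 \<bullet> i - s * (d0 \<bullet> i)" "d1 \<odot> dh \<bullet> i = s * (dh \<bullet> i) / 2"
    "d0 \<odot> dh \<bullet> i = dh \<bullet> i / 2 - s * (dh \<bullet> i) / 2" for i
    using comp[of i] by linarith+
  define e where "e = U ((u - c) + r *\<^sub>R c) d"
  define \<mu> where "\<mu> = r\<^sup>2 * s + (1 - s)"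
  have e: "e = r\<^sup>2 *\<^sub>R d1 + r *\<^sub>R dh + d0"
    unfolding e_def U_peirce_simple[OF c] d1_def dh_def d0_def ..
  have ee: "e \<odot> e = \<mu> *\<^sub>R e"
  proof (rule eq_by_inner)
    fix i
    define x1 xh x0 where "x1 = d1 \<bullet> i" and "xh = dh \<bullet> i" and "x0 = d0 \<bullet> i"
    have "e \<odot> e \<bullet> i = r\<^sup>2 * r\<^sup>2 * (d1 \<odot> d1 \<bullet> i) + r * r * (g1 \<bullet> i + g0 \<bullet> i) + d0 \<odot> d0 \<bullet> i
        + 2 * (r\<^sup>2 * r * (d1 \<odot> dh \<bullet> i)) + 2 * (r * (d0 \<odot> dh \<bullet> i))"
      unfolding e by (simp add: jp_linear cm m g(3) inner_simps power2_eq_square algebra_simps)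
    also have "\<dots> = \<mu> * (r\<^sup>2 * x1 + r * xh + x0)"
      unfolding sol x1_def[symmetric] xh_def[symmetric] x0_def[symmetric] \<mu>_def
      by (simp add: algebra_simps power2_eq_square)
    also have "\<dots> = (\<mu> *\<^sub>R e) \<bullet> i"
      unfolding e x1_def xh_def x0_def by (simp add: inner_simps)
    finally show "e \<odot> e \<bullet> i = (\<mu> *\<^sub>R e) \<bullet> i" .
  qed
  \<comment> \<open>Here s = tf d c / tf d d. Both \<open>c\<close> and \<open>u - c\<close> are
    idempotents and pair nonnegatively with \<open>d\<close>, so s lies between 0 and 1 and \<mu> is
    nonnegative.\<close>
  have t: "tf d d \<ge> 1" using tf_idempotent dd by simp
  have du: "tf d u = tf d d" using tf_assoc[of d d u] dd by (simp add: tf_def)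
  have "s * tf d d = tf (pe1 d c) u" unfolding s tf_linear du ..
  also have "\<dots> = 2 * tf d (d \<odot> c) - tf d c"
    unfolding pe1_def tf_linear tf_assoc unit_right ..
  also have "\<dots> = tf d c" using tf_assoc[of d d c] dd by simp
  finally have st: "s * tf d d = tf d c" .
  have "tf d c \<ge> 0" using tf_idempotents_nonneg dd c by simp
  then have "s * tf d d \<ge> 0" unfolding st .
  then have s0: "s \<ge> 0" using t by (simp add: zero_le_mult_iff)
  have "tf d (u - c) \<ge> 0" using tf_idempotents_nonneg[of d "u - c"] dd c by (simp add: jp_linear)
  then have "(1 - s) * tf d d \<ge> 0" using st du by (simp add: tf_linear algebra_simps)
  then have s1: "1 - s \<ge> 0" using t by (simp add: zero_le_mult_iff)
  have mu: "\<mu> \<ge> 0" unfolding \<mu>_def using s0 s1 by simp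
  show ?thesis
  proof (cases "\<mu> = 0")
    case True
    then have "e \<odot> e = 0" using ee by simp
    then have "e = 0" by (rule square_zero)
    then show ?thesis by (simp flip: e_def)
  next
    case False
    then have "e = (1 / \<mu>) *\<^sub>R (e \<odot> e)" unfolding ee by simp
    then show ?thesis using Apos_scale[OF Apos_square, of "1 / \<mu>" e] mu by (simp flip: e_def)
  qed
qed

text \<open>If an idempotent splits, each part has trace at least 1, so both traces drop by at least
  1; the induction runs over an integer bound on the trace.\<close>

lemma idempotent_induct [consumes 2, case_names primitive sum]:
  assumes "c \<odot> c = c" "c \<noteq> 0"
    and prim: "\<And>d. primitive_idem jp d \<Longrightarrow> P d"
    and add: "\<And>p q. P p \<Longrightarrow> P q \<Longrightarrow> P (p + q)"
  shows "P c"
proof -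
  have "P c" if "trace_of (jp c) \<le> real n" "c \<odot> c = c" "c \<noteq> 0" for n c
    using that
  proof (induction n arbitrary: c)
    case 0
    then show ?case using trace_idempotent_ge_1[of c] by simp
  next
    case (Suc n)
    show ?case
    proof (cases "primitive_idem jp c")
      case False
      then obtain q r where qr: "q \<odot> q = q" "r \<odot> r = r" "q \<noteq> 0" "r \<noteq> 0" "c = q + r"
        using Suc.prems unfolding primitive_idem_def idem_def by blast
      have "trace_of (jp c) = trace_of (jp q) + trace_of (jp r)"
        unfolding qr(5) by (simp add: trace_of_def bilinear_ladd[OF bil] inner_add_left sum.distrib)
      then have "trace_of (jp q) \<le> real n" "trace_of (jp r) \<le> real n"
        using Suc.prems(1) trace_idempotent_ge_1[of q] trace_idempotent_ge_1[of r] qr by auto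
      then show ?thesis using Suc.IH qr add by blast
    qed (rule prim)
  qed
  then show ?thesis using assms(1,2) real_arch_simple[of "trace_of (jp c)"] by blast
qed

lemma U_simple_pos:
  assumes c: "c \<odot> c = c" and x: "x \<in> Apos jp"
  shows "U ((u - c) + r *\<^sub>R c) x \<in> Apos jp"
proof -
  let ?b = "(u - c) + r *\<^sub>R c"
  obtain C f where C: "osys C" "0 \<notin> C" "\<forall>c\<in>C. f c \<ge> 0" "x = (\<Sum>c\<in>C. f c *\<^sub>R c)"
    using spectral_nonneg[OF x] by (elim exE conjE) blast
  have "U ?b d \<in> Apos jp" if "d \<in> C" for d
  proof -
    have d: "d \<odot> d = d" "d \<noteq> 0" using osysD(2)[OF C(1) that] that C(2) by auto
    then show ?thesis
    proof (induction rule: idempotent_induct)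
      case (sum p q)
      then show ?case using linear_add[OF linear_U] Apos_add by metis
    qed (rule U_simple_primitive[OF c])
  qed
  then have "(\<Sum>d\<in>C. f d *\<^sub>R U ?b d) \<in> Apos jp" using C(3) by (intro Apos_sum Apos_scale) auto
  then show ?thesis
    unfolding C(4) linear_sum[OF linear_U] linear_scale[OF linear_U] .
qed

theorem U_pos:
  assumes "x \<in> Apos jp"
  shows "U a x \<in> Apos jp"
proof -
  obtain C f where C: "osys C" "sum id C = u" "a = (\<Sum>c\<in>C. f c *\<^sub>R c)"
    by (rule spectral[of a]) blast
  \<comment> \<open>Eigenvalues outside \<open>D\<close> are replaced by 1: the empty set gives
    \<open>U u\<close>, the identity, and \<open>C\<close> gives \<open>U a\<close>. Adding one
    idempotent composes with one simple factor.\<close>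
  have "\<forall>x\<in>Apos jp. U ((\<Sum>c\<in>D. f c *\<^sub>R c) + (u - sum id D)) x \<in> Apos jp"
    if "finite D" "D \<subseteq> C" for D
    using that
  proof (induction D rule: finite_induct)
    case empty
    then show ?case by (simp add: Uop_def scaleR_2)
  next
    case (insert c D)
    define a' where "a' = (\<Sum>c\<in>D. f c *\<^sub>R c) + (u - sum id D) - c"
    have c: "c \<odot> c = c" using osysD(2)[OF C(1)] insert.prems by blast
    have "c \<odot> d = 0" if "d \<in> D" for d
      using osysD(3)[OF C(1), of c d] that insert by auto
    then have "c \<odot> a' = 0"
      by (simp add: a'_def jp_linear jp_sum_right c)
    note fac = U_factor[OF c this]
    have 1: "(\<Sum>c\<in>insert c D. f c *\<^sub>R c) + (u - sum id (insert c D)) = a' + f c *\<^sub>R c"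
      using insert.hyps by (simp add: a'_def)
    have 2: "(\<Sum>c\<in>D. f c *\<^sub>R c) + (u - sum id D) = a' + c" by (simp add: a'_def)
    show ?case
      unfolding 1 fac using insert.IH insert.prems U_simple_pos[OF c] unfolding 2 by simp
  qed
  from this[OF osysD(1)[OF C(1)] subset_refl] show ?thesis using assms C(2,3) by simp
qed

end

section \<open>Inversion and the order\<close>

text \<open>The interface between gauges and the order: the infimum is attained and positive, so its
  logarithm is controlled by membership alone.\<close>

lemma ln_Inf_le_iff:
  fixes S :: "real set"
  assumes "S \<noteq> {}" "closed S" "\<And>\<beta>. \<beta> \<in> S \<Longrightarrow> 0 < \<beta>"
    and up: "\<And>\<beta> \<gamma>. \<beta> \<in> S \<Longrightarrow> \<beta> \<le> \<gamma> \<Longrightarrow> \<gamma> \<in> S"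
  shows "ln (Inf S) \<le> b \<longleftrightarrow> exp b \<in> S"
proof -
  have bdd: "bdd_below S" using assms(3) by (meson bdd_belowI less_imp_le)
  have mem: "Inf S \<in> S" using closed_contains_Inf assms(1,2) bdd by blast
  have "ln (Inf S) \<le> b \<longleftrightarrow> exp (ln (Inf S)) \<le> exp b" by simp
  also have "\<dots> \<longleftrightarrow> Inf S \<le> exp b" using assms(3)[OF mem] by simp
  also have "\<dots> \<longleftrightarrow> exp b \<in> S" using up[OF mem] cInf_lower[OF _ bdd] by blast
  finally show ?thesis .
qed

context euclidean_jordan
begin

section \<open>The cone order and its gauge\<close>

abbreviation jle (infix "\<preceq>" 50) where "x \<preceq> y \<equiv> cle (Apos jp) x y"

abbreviation iv where "iv \<equiv> jinv jp u"

lemma jle_refl [simp]: "x \<preceq> x"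
  by (simp add: cle_def)

lemma jle_trans: "x \<preceq> y \<Longrightarrow> y \<preceq> z \<Longrightarrow> x \<preceq> z"
  unfolding cle_def using Apos_add[of "y - x" "z - y"] by simp

lemma jle_scale: "x \<preceq> y \<Longrightarrow> r \<ge> 0 \<Longrightarrow> r *\<^sub>R x \<preceq> r *\<^sub>R y"
  unfolding cle_def using Apos_scale[of "y - x" r] by (simp add: scaleR_diff_right)

lemma jle_scale_iff: "r > 0 \<Longrightarrow> r *\<^sub>R x \<preceq> r *\<^sub>R y \<longleftrightarrow> x \<preceq> y"
  using jle_scale[of x y r] jle_scale[of "r *\<^sub>R x" "r *\<^sub>R y" "1 / r"] by auto

lemma jle_mono_scalar: "y \<in> Apos jp \<Longrightarrow> \<beta> \<le> \<gamma> \<Longrightarrow> \<beta> *\<^sub>R y \<preceq> \<gamma> *\<^sub>R y"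
  unfolding cle_def using Apos_scale[of y "\<gamma> - \<beta>"] by (simp add: scaleR_diff_left)

lemma jle_0 [simp]: "0 \<preceq> x \<longleftrightarrow> x \<in> Apos jp"
  by (simp add: cle_def)

lemma jle_zero_imp: "x \<in> Apos jp \<Longrightarrow> x \<preceq> 0 \<Longrightarrow> x = 0"
  using Apos_pointed by (simp add: cle_def)

lemma closed_jle: "closed {\<beta>. x \<preceq> \<beta> *\<^sub>R y}"
proof -
  have "{\<beta>. x \<preceq> \<beta> *\<^sub>R y} = (\<lambda>\<beta>. \<beta> *\<^sub>R y - x) -` Apos jp" by (auto simp: cle_def)
  then show ?thesis
    by (simp only:) (intro closed_vimage closed_Apos continuous_intros)
qed

lemma jle_scalar_pos:
  assumes "x \<in> Apos jp" "x \<noteq> 0" "y \<in> Apos jp" "x \<preceq> \<beta> *\<^sub>R y"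
  shows "\<beta> > 0"
proof (rule ccontr)
  assume "\<not> \<beta> > 0"
  then have "\<beta> *\<^sub>R y \<preceq> 0 *\<^sub>R y" using assms(3) by (intro jle_mono_scalar) auto
  then have "x \<preceq> 0" using jle_trans[OF assms(4)] by simp
  then show False using jle_zero_imp assms by blast
qed

lemma jle_Aint_ex:
  assumes "y \<in> Aint jp"
  shows "\<exists>\<beta>. x \<preceq> \<beta> *\<^sub>R y"
proof -
  obtain e where e: "e > 0" "y - e *\<^sub>R u \<in> Apos jp" using assms by (auto simp: Aint_iff)
  obtain d where d: "d > 0" "\<And>x. norm x < d \<Longrightarrow> u + x \<in> Apos jp" using unit_interior_ball by blast
  \<comment> \<open>The summand 1 covers x = 0, and the factor 2 keeps \<open>t *\<^sub>R x\<close>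
    strictly inside the ball of radius \<open>d\<close>.\<close>
  define t where "t = d / (2 * (norm x + 1))"
  have nx: "norm x + 1 > 0" by (simp add: add_nonneg_pos)
  have t: "t > 0" using d(1) nx by (simp add: t_def)
  have "t * norm x < d" using d(1) nx by (simp add: t_def field_simps) (smt (verit) mult_nonneg_nonneg norm_ge_zero)
  then have "norm (- (t *\<^sub>R x)) < d" using t by simp
  then have "u + - (t *\<^sub>R x) \<in> Apos jp" by (rule d(2))
  then have "t *\<^sub>R x \<preceq> u" by (simp add: cle_def)
  then have "(1 / t) *\<^sub>R (t *\<^sub>R x) \<preceq> (1 / t) *\<^sub>R u" using t by (intro jle_scale) auto
  then have "x \<preceq> (1 / t) *\<^sub>R u" using t by simp
  moreover have "(1 / e) *\<^sub>R (e *\<^sub>R u) \<preceq> (1 / e) *\<^sub>R y" using e by (intro jle_scale) (auto simp: cle_def)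
  then have "(1 / t) *\<^sub>R u \<preceq> (1 / t) *\<^sub>R ((1 / e) *\<^sub>R y)" using e t by (intro jle_scale) auto
  ultimately show ?thesis using jle_trans by (metis scaleR_scaleR)
qed

lemma ln_Mc_le_iff:
  assumes "x \<in> Apos jp" "x \<noteq> 0" "y \<in> Aint jp"
  shows "ln (Mc (Apos jp) x y) \<le> b \<longleftrightarrow> x \<preceq> exp b *\<^sub>R y"
  unfolding Mc_def
proof (subst ln_Inf_le_iff)
  have y: "y \<in> Apos jp" using assms(3) by (rule Aint_Apos)
  show "{\<beta>. x \<preceq> \<beta> *\<^sub>R y} \<noteq> {}" using jle_Aint_ex[OF assms(3)] by auto
  show "0 < \<beta>" if "\<beta> \<in> {\<beta>. x \<preceq> \<beta> *\<^sub>R y}" for \<beta>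
    using jle_scalar_pos[OF assms(1,2) y] that by blast
  show "\<gamma> \<in> {\<beta>. x \<preceq> \<beta> *\<^sub>R y}" if "\<beta> \<in> {\<beta>. x \<preceq> \<beta> *\<^sub>R y}" "\<beta> \<le> \<gamma>" for \<beta> \<gamma>
    using jle_trans jle_mono_scalar[OF y that(2)] that(1) by blast
qed (simp_all add: closed_jle)

section \<open>Inverses in the interior\<close>

lemma jinv_osys:
  assumes C: "osys C" "sum id C = u" "\<And>c. c \<in> C \<Longrightarrow> f c > 0"
  shows "iv (\<Sum>c\<in>C. f c *\<^sub>R c) = (\<Sum>c\<in>C. (1 / f c) *\<^sub>R c)"
proof -
  define x b where "x = (\<Sum>c\<in>C. f c *\<^sub>R c)" and "b = (\<Sum>c\<in>C. (1 / f c) *\<^sub>R c)"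
  have f0: "f c \<noteq> 0" if "c \<in> C" for c using C(3)[OF that] by simp
  have "x \<odot> b = (\<Sum>c\<in>C. (f c * (1 / f c)) *\<^sub>R c)"
    unfolding x_def b_def by (rule osys_mult[OF C(1)])
  also have "\<dots> = sum id C" by (rule sum.cong) (use f0 in auto)
  finally have xb: "x \<odot> b = u" using C(2) by simp
  have "(x \<odot> x) \<odot> b = (\<Sum>c\<in>C. ((f c * f c) * (1 / f c)) *\<^sub>R c)"
    unfolding x_def b_def osys_mult[OF C(1)] by (rule refl)
  also have "\<dots> = x" unfolding x_def by (rule sum.cong) (use f0 in auto)
  finally have xxb: "(x \<odot> x) \<odot> b = x" .
  \<comment> \<open>For the difference \<open>w\<close> of two inverses,
    \<open>tf (x \<odot> w) w = 0\<close> is a sum of nonnegative terms with positive weights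
    \<open>f c\<close>. Each term vanishes, so their unweighted sum \<open>tf w w\<close> does
    too.\<close>
  have uniq: "y = b" if "x \<odot> y = u \<and> (x \<odot> x) \<odot> y = x" for y
  proof -
    define w where "w = y - b"
    have "x \<odot> w = 0" using that xb by (simp add: w_def jp_linear)
    then have "tf (x \<odot> w) w = 0" by simp
    then have "(\<Sum>c\<in>C. f c * tf (c \<odot> w) w) = 0"
      by (simp add: x_def jp_sum_left jp_linear tf_sum tf_linear)
    moreover have nn: "f c * tf (c \<odot> w) w \<ge> 0" if "c \<in> C" for c
      using C(3)[OF that] tf_idempotent_nonneg[OF osysD(2)[OF C(1) that]] by simp
    ultimately have "\<forall>c\<in>C. f c * tf (c \<odot> w) w = 0"
      using sum_nonneg_eq_0_iff[OF osysD(1)[OF C(1)], of "\<lambda>c. f c * tf (c \<odot> w) w"] by blast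
    then have "\<forall>c\<in>C. tf (c \<odot> w) w = 0" using f0 by simp
    then have "(\<Sum>c\<in>C. tf (c \<odot> w) w) = 0" by simp
    then have "tf ((\<Sum>c\<in>C. c) \<odot> w) w = 0" by (simp add: jp_sum_left tf_sum)
    then have "tf w w = 0" using C(2) by (simp add: id_def)
    then show "y = b" by (simp add: tf_eq_0 w_def)
  qed
  have "iv x = b" unfolding jinv_def by (rule the_equality) (use xb xxb uniq in blast)+
  then show ?thesis unfolding x_def b_def .
qed

lemma
  assumes "x \<in> Aint jp"
  shows jinv_Aint: "iv x \<in> Aint jp"
    and jinv_right: "x \<odot> iv x = u"
    and jinv_square: "(iv x \<odot> iv x) \<odot> x = iv x"
    and jinv_commute: "x \<odot> (iv x \<odot> a) = iv x \<odot> (x \<odot> a)"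
    and jinv_jinv: "iv (iv x) = x"
    and jinv_scale: "r > 0 \<Longrightarrow> iv (r *\<^sub>R x) = (1 / r) *\<^sub>R iv x"
proof -
  obtain C f where C: "osys C" "sum id C = u" "\<And>c. c \<in> C \<Longrightarrow> f c > 0" and x: "x = (\<Sum>c\<in>C. f c *\<^sub>R c)"
    by (rule spectral_Aint[OF assms]) blast
  have b: "iv x = (\<Sum>c\<in>C. (1 / f c) *\<^sub>R c)" unfolding x by (rule jinv_osys[OF C])
  have f0: "f c \<noteq> 0" if "c \<in> C" for c using C(3)[OF that] by simp
  have pos: "1 / f c > 0" if "c \<in> C" for c using C(3)[OF that] by simp
  show "iv x \<in> Aint jp" unfolding b by (rule Aint_osys[OF C(1,2) pos])
  have "x \<odot> iv x = (\<Sum>c\<in>C. (f c * (1 / f c)) *\<^sub>R c)"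
    unfolding b unfolding x by (rule osys_mult[OF C(1)])
  also have "\<dots> = sum id C" by (rule sum.cong) (use f0 in auto)
  finally show "x \<odot> iv x = u" using C(2) by simp
  have "(iv x \<odot> iv x) \<odot> x = (\<Sum>c\<in>C. ((1 / f c * (1 / f c)) * f c) *\<^sub>R c)"
    unfolding b unfolding x osys_mult[OF C(1)] by (rule refl)
  also have "\<dots> = iv x" unfolding b by (rule sum.cong) (use f0 in auto)
  finally show "(iv x \<odot> iv x) \<odot> x = iv x" .
  \<comment> \<open>Multiplications by orthogonal idempotents commute, hence so do those by
    \<open>x\<close> and its inverse, both being combinations of the same system.\<close>
  have cd: "c \<odot> (d \<odot> a) = d \<odot> (c \<odot> a)" if "c \<in> C" "d \<in> C" for c d
    using jp_commute_orth[OF osysD(2)[OF C(1) that(1)], of d a] osysD(3)[OF C(1) that]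
    by (cases "c = d") auto
  have "x \<odot> (iv x \<odot> a) = (\<Sum>c\<in>C. \<Sum>d\<in>C. (f c * (1 / f d)) *\<^sub>R (c \<odot> (d \<odot> a)))"
    unfolding b by (subst sum.swap) (simp add: x jp_sum_left jp_sum_right jp_linear scaleR_sum_right)
  also have "\<dots> = (\<Sum>c\<in>C. \<Sum>d\<in>C. (f c * (1 / f d)) *\<^sub>R (d \<odot> (c \<odot> a)))"
    by (intro sum.cong refl) (simp add: cd)
  also have "\<dots> = iv x \<odot> (x \<odot> a)"
    unfolding b by (simp add: x jp_sum_left jp_sum_right jp_linear scaleR_sum_right)
  finally show "x \<odot> (iv x \<odot> a) = iv x \<odot> (x \<odot> a)" .
  have "iv (iv x) = (\<Sum>c\<in>C. (1 / (1 / f c)) *\<^sub>R c)"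
    unfolding b by (rule jinv_osys[OF C(1,2) pos])
  then show "iv (iv x) = x" unfolding x by simp
  assume r: "r > 0"
  have "iv (\<Sum>c\<in>C. (r * f c) *\<^sub>R c) = (\<Sum>c\<in>C. (1 / (r * f c)) *\<^sub>R c)"
    using r C(3) by (intro jinv_osys[OF C(1,2)]) simp
  then show "iv (r *\<^sub>R x) = (1 / r) *\<^sub>R iv x"
    unfolding b by (simp add: x scaleR_sum_right)
qed

text \<open>Order reversal rests on \<open>U\<^bsub>a - b\<^esub> x = U\<^sub>a x - 2 a + b\<close> for \<open>b\<close> the inverse of \<open>x\<close>, applied with
  \<open>a\<close> the inverse of \<open>w\<close>, so that \<open>U\<^sub>a w = a\<close>.\<close>
lemma jinv_antimono:
  assumes x: "x \<in> Aint jp" and w: "w \<in> Aint jp" and le: "x \<preceq> w"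
  shows "iv w \<preceq> iv x"
proof -
  define a b where "a = iv w" and "b = iv x"
  have bx: "b \<odot> x = u" "(b \<odot> b) \<odot> x = b" "b \<odot> (a \<odot> x) = (a \<odot> b) \<odot> x"
    using jinv_right[OF x] jinv_square[OF x] jinv_commute[OF x, of a]
    by (simp_all add: b_def comm)
  have aw: "a \<odot> w = u" "(a \<odot> a) \<odot> w = a"
    using jinv_right[OF w] jinv_square[OF w] by (simp_all add: a_def comm)
  have "U (a - b) x = U a x - 2 *\<^sub>R a + b"
    unfolding Uop_def
    by (rule eq_by_inner) (simp add: jp_linear bx comm[of b a] inner_simps)
  moreover have "U a w = a" unfolding Uop_def by (simp add: aw scaleR_2)
  ultimately have "U (a - b) x + U a (w - x) = b - a"
    by (simp add: linear_diff[OF linear_U] scaleR_2)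
  moreover have "U (a - b) x \<in> Apos jp" "U a (w - x) \<in> Apos jp"
    using U_pos Aint_Apos[OF x] le by (auto simp: cle_def)
  ultimately show ?thesis unfolding cle_def a_def b_def by (metis Apos_add)
qed

lemma jle_jinv_iff:
  assumes x: "x \<in> Aint jp" and w: "w \<in> Aint jp" and r: "r > 0"
  shows "x \<preceq> r *\<^sub>R w \<longleftrightarrow> iv w \<preceq> r *\<^sub>R iv x"
proof -
  have 1: "iv w \<preceq> r *\<^sub>R iv x" if x: "x \<in> Aint jp" and w: "w \<in> Aint jp" and "x \<preceq> r *\<^sub>R w" for x w
  proof -
    have "iv (r *\<^sub>R w) \<preceq> iv x" using jinv_antimono[OF x Aint_scale[OF w r]] that(3) .
    then have "r *\<^sub>R ((1 / r) *\<^sub>R iv w) \<preceq> r *\<^sub>R iv x"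
      unfolding jinv_scale[OF w r] using r by (intro jle_scale) auto
    then show ?thesis using r by simp
  qed
  show ?thesis using 1[OF x w] 1[OF jinv_Aint[OF w] jinv_Aint[OF x]] x w by (auto simp: jinv_jinv)
qed

section \<open>The Thompson metric and the horofunction formula as order relations\<close>

lemma dT_le_iff:
  assumes "x \<in> Aint jp" "w \<in> Aint jp"
  shows "dT jp x w \<le> b \<longleftrightarrow> x \<preceq> exp b *\<^sub>R w \<and> w \<preceq> exp b *\<^sub>R x"
  unfolding dT_def
  using ln_Mc_le_iff[OF Aint_Apos[OF assms(1)] Aint_nonzero[OF assms(1)] assms(2), of b]
    ln_Mc_le_iff[OF Aint_Apos[OF assms(2)] Aint_nonzero[OF assms(2)] assms(1), of b] by simp

text \<open>Inverting one of the two conditions puts \<open>w\<close> and its inverse on the left of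
  both, which matches the shape of \<open>horo_formula_le_iff\<close>.\<close>

lemma dT_le_iff_jinv:
  assumes "x \<in> Aint jp" "w \<in> Aint jp"
  shows "dT jp x w \<le> b \<longleftrightarrow> w \<preceq> exp b *\<^sub>R x \<and> iv w \<preceq> exp b *\<^sub>R iv x"
  unfolding dT_le_iff[OF assms] using jle_jinv_iff[OF assms, of "exp b"] by auto

lemma jle_exp_trans:
  assumes "x \<preceq> exp a *\<^sub>R y" "y \<preceq> exp b *\<^sub>R z"
  shows "x \<preceq> exp (a + b) *\<^sub>R z"
proof -
  have "exp a *\<^sub>R y \<preceq> exp a *\<^sub>R (exp b *\<^sub>R z)" using assms(2) by (intro jle_scale) auto
  then show ?thesis using jle_trans[OF assms(1)] by (simp add: exp_add)
qed

lemma dT_triangle: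
  assumes x: "x \<in> Aint jp" and y: "y \<in> Aint jp" and z: "z \<in> Aint jp"
  shows "dT jp x z \<le> dT jp x y + dT jp y z"
proof -
  have "x \<preceq> exp (dT jp x y) *\<^sub>R y" "y \<preceq> exp (dT jp x y) *\<^sub>R x"
    using dT_le_iff[OF x y, of "dT jp x y"] by auto
  moreover have "y \<preceq> exp (dT jp y z) *\<^sub>R z" "z \<preceq> exp (dT jp y z) *\<^sub>R y"
    using dT_le_iff[OF y z, of "dT jp y z"] by auto
  ultimately show ?thesis
    unfolding dT_le_iff[OF x z] 
    using jle_exp_trans[of x "dT jp x y" y "dT jp y z" z]
      jle_exp_trans[of z "dT jp y z" y "dT jp x y" x] by (simp add: add.commute)
qed

text \<open>The case distinction in \<open>horo_formula\<close> disappears here, because a zero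
  vector satisfies its inequality automatically.\<close>

lemma horo_formula_le_iff:
  assumes "y \<in> Apos jp" "z \<in> Apos jp" "y \<noteq> 0 \<or> z \<noteq> 0" "x \<in> Aint jp"
  shows "horo_formula jp u y z x \<le> b \<longleftrightarrow> y \<preceq> exp b *\<^sub>R x \<and> z \<preceq> exp b *\<^sub>R iv x"
proof -
  have pos: "exp b *\<^sub>R x \<in> Apos jp" "exp b *\<^sub>R iv x \<in> Apos jp"
    using Apos_scale Aint_Apos assms(4) jinv_Aint by auto
  note My = ln_Mc_le_iff[OF assms(1) _ assms(4), of b]
    and Mz = ln_Mc_le_iff[OF assms(2) _ jinv_Aint[OF assms(4)], of b]
  consider "y = 0" "z \<noteq> 0" | "y \<noteq> 0" "z = 0" | "y \<noteq> 0" "z \<noteq> 0"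
    using assms(3) by blast
  then show ?thesis
    by cases (use pos My Mz in \<open>simp_all add: horo_formula_def\<close>)
qed

end

section \<open>Horofunctions and the detour cost\<close>

lemma tendsto_fun:
  fixes F :: "'b \<Rightarrow> 'c \<Rightarrow> 'd::topological_space"
  shows "(F \<longlongrightarrow> f) net \<longleftrightarrow> (\<forall>i. ((\<lambda>n. F n i) \<longlongrightarrow> f i) net)"
  using limitin_componentwise[of "\<lambda>_. euclidean" UNIV F f net]
  by (simp add: euclidean_product_topology)

context euclidean_jordan
begin

text \<open>The triangle inequality gives the bound for each \<open>hw\<close>, and the bound is a
  closed condition on two coordinates.\<close>

lemma hw_lipschitz:
  assumes "h \<in> closure (hw jp u ` Aint jp)" and x: "x \<in> Aint jp" and w: "w \<in> Aint jp"
  shows "h x - h w \<le> dT jp x w"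
proof -
  have "hw jp u ` Aint jp \<subseteq> {g. g x - g w \<le> dT jp x w}"
  proof clarify
    fix v assume v: "v \<in> Aint jp"
    show "hw jp u v x - hw jp u v w \<le> dT jp x w"
      using dT_triangle[OF x w v] x w by (simp add: hw_def)
  qed
  moreover have "closed {g. g x - g w \<le> dT jp x w}"
    by (intro closed_Collect_le continuous_intros continuous_on_product_coordinates)
  ultimately show ?thesis using closure_minimal assms(1) by blast
qed

text \<open>Limits inherit the normalization at \<open>u\<close> and the default value 0 off the
  interior, so points outside the cone do not affect pointwise convergence.\<close>

lemma hw_closure_value:
  assumes "h \<in> closure (hw jp u ` Aint jp)" "x \<notin> Aint jp \<or> x = u"
  shows "h x = 0"
proof -
  have "hw jp u ` Aint jp \<subseteq> {g. g x = 0}"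
    using assms(2) by (auto simp: hw_def)
  moreover have "closed {g :: 'a \<Rightarrow> real. g x = 0}"
    by (intro closed_Collect_eq continuous_intros continuous_on_product_coordinates)
  ultimately show ?thesis using closure_minimal assms(1) by blast
qed

section \<open>Sequences converging to a horofunction\<close>

text \<open>\<open>tf y z = 0\<close> expands into nonnegative terms
  \<open>f c * g d * tf c d\<close> with positive weights, so each \<open>tf c d\<close> vanishes,
  and \<open>tf_idempotent_zero\<close> gives a zero product.\<close>

lemma orth_idempotents:
  assumes y: "osys C" "y = (\<Sum>c\<in>C. f c *\<^sub>R c)" "\<And>c. c \<in> C \<Longrightarrow> f c > 0"
    and z: "osys D" "z = (\<Sum>d\<in>D. g d *\<^sub>R d)" "\<And>d. d \<in> D \<Longrightarrow> g d > 0"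
    and yz: "y \<odot> z = 0" and c: "c \<in> C" and d: "d \<in> D"
  shows "c \<odot> d = 0"
proof -
  note idc = osysD(2)[OF y(1)] and idd = osysD(2)[OF z(1)]
  have "tf y z = 0" using yz by (simp add: tf_def trace_of_def)
  then have "(\<Sum>c\<in>C. \<Sum>d\<in>D. f c * (g d * tf c d)) = 0"
    unfolding y(2) z(2) by (simp add: tf_sum(1) tf_linear(3)) (simp add: tf_sum(2) tf_linear(4) sum_distrib_left)
  moreover have nn: "f c * (g d * tf c d) \<ge> 0" if "c \<in> C" "d \<in> D" for c d
    using y(3)[OF that(1)] z(3)[OF that(2)] tf_idempotents_nonneg[OF idc idd] that by simp
  moreover have "(\<Sum>d\<in>D. f c * (g d * tf c d)) \<ge> 0" if "c \<in> C" for c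
    using nn that by (intro sum_nonneg)
  ultimately have "(\<Sum>d\<in>D. f c * (g d * tf c d)) = 0"
    using sum_nonneg_0[OF osysD(1)[OF y(1)], of "\<lambda>c. \<Sum>d\<in>D. f c * (g d * tf c d)"] c by blast
  then have "f c * (g d * tf c d) = 0"
    using sum_nonneg_0[OF osysD(1)[OF z(1)], of "\<lambda>d. f c * (g d * tf c d)"] nn c d by blast
  then have "tf c d = 0" using y(3)[OF c] z(3)[OF d] by simp
  then have "tf (c \<odot> d) d = 0" by (simp add: tf_assoc idd d)
  then show ?thesis using tf_idempotent_zero[OF idc[OF c]] by blast
qed

lemma spectral_pos_part:
  assumes "y \<in> Apos jp"
  obtains C f where "osys C" "0 \<notin> C" "\<And>c. c \<in> C \<Longrightarrow> f c > 0" "y = (\<Sum>c\<in>C. f c *\<^sub>R c)"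
proof -
  obtain C f where C: "osys C" "0 \<notin> C" "\<forall>c\<in>C. f c \<ge> 0" "y = (\<Sum>c\<in>C. f c *\<^sub>R c)"
    using spectral_nonneg[OF assms] by (elim exE conjE) blast
  let ?D = "{c \<in> C. f c > 0}"
  have "y = (\<Sum>c\<in>?D. f c *\<^sub>R c)"
    unfolding C(4) using C(3) osysD(1)[OF C(1)] by (intro sum.mono_neutral_right) force+
  moreover have "osys ?D" by (rule osys_subset[OF C(1)]) blast
  ultimately show thesis using C(2) by (intro that[of ?D f]) auto
qed

text \<open>\<open>y\<close> and \<open>z\<close> are diagonal in one common system, completed by
  the idempotent \<open>r\<close>. Here \<open>y1\<close> and \<open>z1\<close> are the inverses of
  \<open>y\<close> and \<open>z\<close> on their own supports, so inversion exchanges the two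
  roles.\<close>

lemma geodesic:
  assumes y: "y \<in> Apos jp" and z: "z \<in> Apos jp" and yz: "y \<odot> z = 0"
  obtains y1 z1 r where "y1 \<in> Apos jp" "z1 \<in> Apos jp" "r \<in> Apos jp"
    "\<And>s. s > 0 \<Longrightarrow> s *\<^sub>R y + (1 / s) *\<^sub>R z1 + r \<in> Aint jp"
    "\<And>s. s > 0 \<Longrightarrow> iv (s *\<^sub>R y + (1 / s) *\<^sub>R z1 + r) = s *\<^sub>R z + (1 / s) *\<^sub>R y1 + r"
proof -
  obtain C f where C: "osys C" "0 \<notin> C" "\<And>c. c \<in> C \<Longrightarrow> f c > 0" "y = (\<Sum>c\<in>C. f c *\<^sub>R c)"
    by (rule spectral_pos_part[OF y]) blast
  obtain D g where D: "osys D" "0 \<notin> D" "\<And>d. d \<in> D \<Longrightarrow> g d > 0" "z = (\<Sum>d\<in>D. g d *\<^sub>R d)"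
    by (rule spectral_pos_part[OF z]) blast
  have cd: "c \<odot> d = 0" if "c \<in> C" "d \<in> D" for c d
    by (rule orth_idempotents[OF C(1) C(4) C(3) D(1) D(4) D(3) yz that])
  have dc: "d \<odot> c = 0" if "c \<in> C" "d \<in> D" for c d
    using cd[OF that] comm by metis
  note fin = osysD(1)[OF C(1)] osysD(1)[OF D(1)]
  note idem = osysD(2)[OF C(1)] osysD(2)[OF D(1)]
  have dj: "C \<inter> D = {}" using cd idem C(2) by (metis disjoint_iff)
  have CD: "osys (C \<union> D)"
    unfolding osys_def using fin idem cd dc osysD(3)[OF C(1)] osysD(3)[OF D(1)] by auto
  define r where "r = u - sum id (C \<union> D)"
  have er: "e \<odot> r = 0" if "e \<in> C \<union> D" for e
    using osys_comp[OF CD that, of "\<lambda>_. 1"] osysD(2)[OF CD that]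
    by (simp add: r_def jp_linear id_def)
  have "r \<odot> r = r \<odot> (u - sum id (C \<union> D))" by (simp add: r_def)
  also have "\<dots> = r - (\<Sum>e\<in>C \<union> D. r \<odot> e)"
    unfolding bilinear_rsub[OF bil] jp_sum_right by simp
  also have "\<dots> = r" using er comm by simp
  finally have rr: "r \<odot> r = r" .
  have rn: "r \<notin> C \<union> D" using er rr C(2) D(2) by (metis Un_iff)
  have E: "osys (insert r (C \<union> D))"
    using CD rr er unfolding osys_def by (auto simp: comm)
  have Eu: "sum id (insert r (C \<union> D)) = u" using fin rn by (simp add: r_def)
  \<comment> \<open>The eigenvalues of the point with parameter \<open>s\<close>: growing on the
    support of \<open>y\<close>, decaying on that of \<open>z\<close>, and 1 on
    \<open>r\<close>.\<close>
  define ph where "ph = (\<lambda>(s::real) e. if e \<in> C then s * f e else if e \<in> D then 1 / (s * g e) else 1)"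
  have php: "ph s e > 0" if "s > 0" for s e
    using that C(3) D(3) by (simp add: ph_def)
  have split: "(\<Sum>e\<in>insert r (C \<union> D). k e *\<^sub>R e) = (\<Sum>e\<in>C. k e *\<^sub>R e) + (\<Sum>e\<in>D. k e *\<^sub>R e) + k r *\<^sub>R r" for k
    using fin rn dj by (simp add: sum.union_disjoint)
  have phr: "ph s r = 1" for s using rn by (simp add: ph_def)
  have phC: "ph s e = s * f e" if "e \<in> C" for s e using that by (simp add: ph_def)
  have phD: "ph s e = 1 / (s * g e)" if "e \<in> D" for s e using that dj by (auto simp: ph_def)
  define y1 z1 where "y1 = (\<Sum>c\<in>C. (1 / f c) *\<^sub>R c)" and "z1 = (\<Sum>d\<in>D. (1 / g d) *\<^sub>R d)"
  have X: "s *\<^sub>R y + (1 / s) *\<^sub>R z1 + r = (\<Sum>e\<in>insert r (C \<union> D). ph s e *\<^sub>R e)" for s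
    unfolding split phr C(4) z1_def by (simp add: phC phD scaleR_sum_right)
  have Y: "s *\<^sub>R z + (1 / s) *\<^sub>R y1 + r = (\<Sum>e\<in>insert r (C \<union> D). (1 / ph s e) *\<^sub>R e)" for s
    unfolding split phr D(4) y1_def by (simp add: phC phD scaleR_sum_right)
  show thesis
  proof (rule that[of y1 z1 r])
    show "y1 \<in> Apos jp" unfolding y1_def using C(3) by (intro Apos_osys[OF C(1)]) (simp add: less_imp_le)
    show "z1 \<in> Apos jp" unfolding z1_def using D(3) by (intro Apos_osys[OF D(1)]) (simp add: less_imp_le)
    show "r \<in> Apos jp" using rr by (rule Apos_idempotent)
    fix s :: real assume s: "s > 0"
    show "s *\<^sub>R y + (1 / s) *\<^sub>R z1 + r \<in> Aint jp"
      unfolding X using php[OF s] by (intro Aint_osys[OF E Eu])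
    show "iv (s *\<^sub>R y + (1 / s) *\<^sub>R z1 + r) = s *\<^sub>R z + (1 / s) *\<^sub>R y1 + r"
      unfolding X Y using php[OF s] by (intro jinv_osys[OF E Eu])
  qed
qed

text \<open>The parameter is s = exp n. After scaling by q = exp (-n) the remainders are q^2 z1 + q
  r and q^2 y1 + q r, which lie in the cone and tend to zero.\<close>

lemma geodesic_sequence:
  assumes y: "y \<in> Apos jp" and z: "z \<in> Apos jp" and yz: "y \<odot> z = 0"
  obtains X where "\<And>n. X n \<in> Aint jp"
    "\<And>n. y \<preceq> exp (- real n) *\<^sub>R X n" "\<And>n. z \<preceq> exp (- real n) *\<^sub>R iv (X n)"
    "(\<lambda>n. exp (- real n) *\<^sub>R X n) \<longlonglongrightarrow> y" "(\<lambda>n. exp (- real n) *\<^sub>R iv (X n)) \<longlonglongrightarrow> z"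
proof -
  obtain y1 z1 r where g: "y1 \<in> Apos jp" "z1 \<in> Apos jp" "r \<in> Apos jp"
    "\<And>s. s > 0 \<Longrightarrow> s *\<^sub>R y + (1 / s) *\<^sub>R z1 + r \<in> Aint jp"
    "\<And>s. s > 0 \<Longrightarrow> iv (s *\<^sub>R y + (1 / s) *\<^sub>R z1 + r) = s *\<^sub>R z + (1 / s) *\<^sub>R y1 + r"
    by (rule geodesic[OF assms]) blast
  define q where "q = (\<lambda>n. exp (- real n))"
  define X where "X = (\<lambda>n. exp (real n) *\<^sub>R y + (1 / exp (real n)) *\<^sub>R z1 + r)"
  have X: "X n \<in> Aint jp" for n unfolding X_def by (rule g(4)) simp
  have iX: "iv (X n) = exp (real n) *\<^sub>R z + (1 / exp (real n)) *\<^sub>R y1 + r" for n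
    unfolding X_def by (rule g(5)) simp
  have q: "q n * exp (real n) = 1" "1 / exp (real n) = q n" "q n \<ge> 0" for n
    by (simp_all add: q_def exp_minus field_simps)
  have e: "q n *\<^sub>R (exp (real n) *\<^sub>R a + (1 / exp (real n)) *\<^sub>R b + r) = a + ((q n * q n) *\<^sub>R b + q n *\<^sub>R r)"
    for n a b unfolding q(2) by (simp add: scaleR_add_right q(1) add.assoc)
  have "q = (\<lambda>n. exp (-1) ^ n)" by (simp add: q_def fun_eq_iff exp_of_nat_mult[symmetric])
  moreover have "(\<lambda>n. exp (-1::real) ^ n) \<longlonglongrightarrow> 0" by (rule LIMSEQ_realpow_zero) simp_all
  ultimately have q0: "q \<longlonglongrightarrow> 0" by simp
  have lim: "(\<lambda>n. a + ((q n * q n) *\<^sub>R b + q n *\<^sub>R r)) \<longlonglongrightarrow> a" for a b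
  proof -
    have "(\<lambda>n. a + ((q n * q n) *\<^sub>R b + q n *\<^sub>R r)) \<longlonglongrightarrow> a + ((0 * 0) *\<^sub>R b + 0 *\<^sub>R r)"
      by (intro tendsto_intros q0)
    then show ?thesis by simp
  qed
  have le: "a \<preceq> a + ((q n * q n) *\<^sub>R b + q n *\<^sub>R r)" if "b \<in> Apos jp" for n a b
    unfolding cle_def using that g(3) q(3) by (simp add: Apos_add Apos_scale)
  have eX: "exp (- real n) *\<^sub>R X n = y + ((q n * q n) *\<^sub>R z1 + q n *\<^sub>R r)" for n
    using e[of n y z1] unfolding X_def q_def .
  have eY: "exp (- real n) *\<^sub>R iv (X n) = z + ((q n * q n) *\<^sub>R y1 + q n *\<^sub>R r)" for n
    using e[of n z y1] unfolding iX q_def .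
  show thesis
  proof (rule that[of X])
    show "X n \<in> Aint jp" for n by (rule X)
    show "y \<preceq> exp (- real n) *\<^sub>R X n" for n unfolding eX by (rule le[OF g(2)])
    show "z \<preceq> exp (- real n) *\<^sub>R iv (X n)" for n unfolding eY by (rule le[OF g(1)])
  qed (unfold eX eY, rule lim, rule lim)
qed

text \<open>The slack \<open>(exp b - exp a) *\<^sub>R x\<close> moves the limit of the differences
  into the open interior.\<close>

lemma eventually_jle_strict:
  assumes "F \<longlonglongrightarrow> y" "y \<preceq> exp a *\<^sub>R x" "x \<in> Aint jp" "a < b"
  shows "eventually (\<lambda>n. F n \<preceq> exp b *\<^sub>R x) sequentially"
proof -
  have "(exp b - exp a) *\<^sub>R x + (exp a *\<^sub>R x - y) \<in> Aint jp"
    using assms by (intro Aint_add Aint_scale) (auto simp: cle_def)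
  then have "exp b *\<^sub>R x - y \<in> Aint jp" by (simp add: scaleR_diff_left)
  moreover have "(\<lambda>n. exp b *\<^sub>R x - F n) \<longlonglongrightarrow> exp b *\<^sub>R x - y" by (intro tendsto_intros assms(1))
  moreover have "open (Aint jp)" by (simp add: Aint_def)
  ultimately have "eventually (\<lambda>n. exp b *\<^sub>R x - F n \<in> Aint jp) sequentially"
    using topological_tendstoD by blast
  then show ?thesis by (rule eventually_mono) (simp add: cle_def Aint_Apos)
qed

lemma jle_limit:
  assumes "F \<longlonglongrightarrow> y" "\<And>n. x \<preceq> b *\<^sub>R F n"
  shows "x \<preceq> b *\<^sub>R y"
proof -
  have "(\<lambda>n. b *\<^sub>R F n - x) \<longlonglongrightarrow> b *\<^sub>R y - x" by (intro tendsto_intros assms(1))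
  then show ?thesis
    using closed_sequentially[OF closed_Apos, of "\<lambda>n. b *\<^sub>R F n - x"] assms(2)
    unfolding cle_def by simp
qed

lemma jle_exp_shift: "exp (- t) *\<^sub>R w \<preceq> exp b *\<^sub>R x \<longleftrightarrow> w \<preceq> exp (t + b) *\<^sub>R x"
proof -
  have "exp t *\<^sub>R (exp (- t) *\<^sub>R w) \<preceq> exp t *\<^sub>R (exp b *\<^sub>R x) \<longleftrightarrow> exp (- t) *\<^sub>R w \<preceq> exp b *\<^sub>R x"
    by (rule jle_scale_iff) simp
  then show ?thesis by (simp add: exp_add[symmetric])
qed

text \<open>The scaled points dominate \<open>y\<close> and \<open>z\<close>, so the formula is a
  lower bound for every n. Any strictly larger bound holds eventually, by
  \<open>eventually_jle_strict\<close>.\<close>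

lemma dT_geodesic_limit:
  assumes y: "y \<in> Apos jp" and z: "z \<in> Apos jp" and ne: "y \<noteq> 0 \<or> z \<noteq> 0"
    and X: "\<And>n. X n \<in> Aint jp"
    "\<And>n. y \<preceq> exp (- real n) *\<^sub>R X n" "\<And>n. z \<preceq> exp (- real n) *\<^sub>R iv (X n)"
    "(\<lambda>n. exp (- real n) *\<^sub>R X n) \<longlonglongrightarrow> y" "(\<lambda>n. exp (- real n) *\<^sub>R iv (X n)) \<longlonglongrightarrow> z"
    and x: "x \<in> Aint jp"
  shows "(\<lambda>n. dT jp x (X n) - real n) \<longlonglongrightarrow> horo_formula jp u y z x"
proof (rule order_tendstoI)
  let ?h = "horo_formula jp u y z x"
  note hle = horo_formula_le_iff[OF y z ne x]
  have dle: "dT jp x (X n) - real n \<le> b \<longleftrightarrow>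
    exp (- real n) *\<^sub>R X n \<preceq> exp b *\<^sub>R x \<and> exp (- real n) *\<^sub>R iv (X n) \<preceq> exp b *\<^sub>R iv x" for n b
    using dT_le_iff_jinv[OF x X(1), of n "real n + b"] by (simp add: jle_exp_shift algebra_simps)
  have low: "?h \<le> dT jp x (X n) - real n" for n
    using dle[of n "dT jp x (X n) - real n"] X(2,3)[of n] hle jle_trans by blast
  show "eventually (\<lambda>n. a < dT jp x (X n) - real n) sequentially" if "a < ?h" for a
    using low that by (auto intro: always_eventually less_le_trans)
  show "eventually (\<lambda>n. dT jp x (X n) - real n < a) sequentially" if "?h < a" for a
  proof -
    obtain b where b: "?h < b" "b < a" using \<open>?h < a\<close> dense by blast
    have "y \<preceq> exp ?h *\<^sub>R x" "z \<preceq> exp ?h *\<^sub>R iv x" using hle[of ?h] by auto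
    then have "eventually (\<lambda>n. exp (- real n) *\<^sub>R X n \<preceq> exp b *\<^sub>R x) sequentially"
      "eventually (\<lambda>n. exp (- real n) *\<^sub>R iv (X n) \<preceq> exp b *\<^sub>R iv x) sequentially"
      using eventually_jle_strict X(4,5) x jinv_Aint[OF x] b(1) by blast+
    then have "eventually (\<lambda>n. dT jp x (X n) - real n \<le> b) sequentially"
      unfolding dle by (rule eventually_conj)
    then show ?thesis by (rule eventually_mono) (use b(2) in auto)
  qed
qed

text \<open>Uses that limits of the functions \<open>h\<^sub>w\<close> are 1-Lipschitz.\<close>
lemma detour_cost_ge:
  assumes h': "h' \<in> closure (hw jp u ` Aint jp)" and x0: "x0 \<in> Aint jp"
  shows "ereal (h' x0 - h x0) \<le> detour_cost jp u h h'"
proof (rule ereal_le_epsilon2)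
  fix e :: real assume e: "e > 0"
  \<comment> \<open>A neighbourhood that constrains only the value at \<open>x0\<close> already
    suffices for the lower bound.\<close>
  define W where "W = {g :: 'a \<Rightarrow> real. g x0 < h x0 + e}"
  have "open W" unfolding W_def
    by (intro open_Collect_less continuous_intros continuous_on_product_coordinates)
  moreover have "h \<in> W" using e by (simp add: W_def)
  ultimately have W: "W \<in> {W. open W \<and> h \<in> W}" by blast
  have "ereal (h' x0 - h x0 - e) \<le> (INF x\<in>{x \<in> Aint jp. hw jp u x \<in> W}. ereal (dT jp u x + h' x))"
  proof (rule INF_greatest)
    fix x assume "x \<in> {x \<in> Aint jp. hw jp u x \<in> W}"
    then have x: "x \<in> Aint jp" and "dT jp x0 x - dT jp u x < h x0 + e"
      using x0 by (auto simp: W_def hw_def)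
    moreover have "h' x0 - h' x \<le> dT jp x0 x" by (rule hw_lipschitz[OF h' x0 x])
    ultimately show "ereal (h' x0 - h x0 - e) \<le> ereal (dT jp u x + h' x)" by simp
  qed
  also have "\<dots> \<le> detour_cost jp u h h'"
    unfolding detour_cost_def by (rule SUP_upper[OF W])
  finally have "ereal (h' x0 - h x0 - e) + ereal e \<le> detour_cost jp u h h' + ereal e"
    by (rule add_right_mono)
  then show "ereal (h' x0 - h x0) \<le> detour_cost jp u h h' + ereal e" by simp
qed

theorem detour_cost_le_iff:
  assumes h: "h \<in> closure (hw jp u ` Aint jp)" and h': "h' \<in> closure (hw jp u ` Aint jp)"
    and hdef: "\<forall>x\<in>Aint jp. h x = horo_formula jp u y z x"
    and hdef': "\<forall>x\<in>Aint jp. h' x = horo_formula jp u y' z' x"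
    and y: "y \<in> Apos jp" and z: "z \<in> Apos jp" and y': "y' \<in> Apos jp" and z': "z' \<in> Apos jp"
    and yz: "y \<odot> z = 0" and ne: "y \<noteq> 0 \<or> z \<noteq> 0" and ne': "y' \<noteq> 0 \<or> z' \<noteq> 0"
  shows "detour_cost jp u h h' \<le> ereal b \<longleftrightarrow> y' \<preceq> exp b *\<^sub>R y \<and> z' \<preceq> exp b *\<^sub>R z"
proof -
  obtain X where X: "\<And>n. X n \<in> Aint jp"
    "\<And>n. y \<preceq> exp (- real n) *\<^sub>R X n" "\<And>n. z \<preceq> exp (- real n) *\<^sub>R iv (X n)"
    "(\<lambda>n. exp (- real n) *\<^sub>R X n) \<longlonglongrightarrow> y" "(\<lambda>n. exp (- real n) *\<^sub>R iv (X n)) \<longlonglongrightarrow> z"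
    by (rule geodesic_sequence[OF y z yz]) blast
  note hle = horo_formula_le_iff[OF y z ne X(1)] and hle' = horo_formula_le_iff[OF y' z' ne' X(1)]
  have hX: "h (X n) \<le> - real n" for n
    using hle[of n "- real n"] X(2,3) hdef X(1) by simp
  have h'X: "h' (X n) + real n \<le> b \<longleftrightarrow>
      y' \<preceq> exp b *\<^sub>R (exp (- real n) *\<^sub>R X n) \<and> z' \<preceq> exp b *\<^sub>R (exp (- real n) *\<^sub>R iv (X n))" for n b
    using hle'[of n "b - real n"] hdef' X(1)
    by (simp add: exp_diff exp_minus divide_inverse le_diff_eq)
  note lim = dT_geodesic_limit[OF y z ne X]
  show ?thesis
  proof
    assume le: "detour_cost jp u h h' \<le> ereal b"
    \<comment> \<open>\<open>detour_cost_ge\<close> is applied at the points of the sequence, where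
      \<open>h\<close> is at most -n.\<close>
    have "h' (X n) + real n \<le> b" for n
    proof -
      have "ereal (h' (X n) - h (X n)) \<le> ereal b"
        using detour_cost_ge[OF h' X(1)] le by (rule order_trans)
      then show ?thesis using hX[of n] by simp
    qed
    then show "y' \<preceq> exp b *\<^sub>R y \<and> z' \<preceq> exp b *\<^sub>R z"
      unfolding h'X using jle_limit X(4,5) by blast
  next
    assume le: "y' \<preceq> exp b *\<^sub>R y \<and> z' \<preceq> exp b *\<^sub>R z"
    have b: "h' (X n) + real n \<le> b" for n
      unfolding h'X
      using jle_trans[OF conjunct1[OF le] jle_scale[OF X(2)[of n], of "exp b"]]
        jle_trans[OF conjunct2[OF le] jle_scale[OF X(3)[of n], of "exp b"]] by simp
    \<comment> \<open>As h(u) = 0, the quantity dT(u, X n) - n tends to 0; hence the sequence both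
      converges to \<open>h\<close> and realizes the bound up to \<open>e\<close>.\<close>
    have hu: "horo_formula jp u y z u = 0" using hdef hw_closure_value[OF h, of u] Aint_unit by simp
    have conv: "(\<lambda>n. hw jp u (X n)) \<longlonglongrightarrow> h"
      unfolding tendsto_fun
    proof
      fix x
      show "(\<lambda>n. hw jp u (X n) x) \<longlonglongrightarrow> h x"
      proof (cases "x \<in> Aint jp")
        case True
        have "(\<lambda>n. (dT jp x (X n) - real n) - (dT jp u (X n) - real n))
           \<longlonglongrightarrow> horo_formula jp u y z x - horo_formula jp u y z u"
          by (intro tendsto_diff lim True Aint_unit)
        then show ?thesis using True hdef hu by (simp add: hw_def)
      next
        case False
        then show ?thesis using hw_closure_value[OF h, of x] by (simp add: hw_def)
      qed
    qed
    show "detour_cost jp u h h' \<le> ereal b"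
      unfolding detour_cost_def
    proof (rule SUP_least)
      fix W assume W: "W \<in> {W. open W \<and> h \<in> W}"
      show "(INF x\<in>{x \<in> Aint jp. hw jp u x \<in> W}. ereal (dT jp u x + h' x)) \<le> ereal b"
      proof (rule ereal_le_epsilon2)
        fix e :: real assume "e > 0"
        then have "eventually (\<lambda>n. dT jp u (X n) - real n < e) sequentially"
          using order_tendstoD(2)[OF lim[OF Aint_unit]] hu by simp
        moreover have "eventually (\<lambda>n. hw jp u (X n) \<in> W) sequentially"
          using topological_tendstoD[OF conv] W by blast
        ultimately have "eventually (\<lambda>n. dT jp u (X n) - real n < e \<and> hw jp u (X n) \<in> W) sequentially"
          by (rule eventually_conj)
        then obtain n where n: "dT jp u (X n) - real n < e" "hw jp u (X n) \<in> W"
          using eventually_happens' sequentially_bot by blast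
        have "(INF x\<in>{x \<in> Aint jp. hw jp u x \<in> W}. ereal (dT jp u x + h' x))
            \<le> ereal (dT jp u (X n) + h' (X n))"
          using n(2) X(1) by (intro INF_lower) simp
        also have "\<dots> \<le> ereal b + ereal e" using n(1) b[of n] by simp
        finally show "(INF x\<in>{x \<in> Aint jp. hw jp u x \<in> W}. ereal (dT jp u x + h' x)) \<le> ereal b + ereal e" .
      qed
    qed
  qed
qed

text \<open>With this, the normalization of the maximum to 1 excludes that both vectors are
  zero.\<close>

lemma unorm_zero: "unorm jp u 0 = 0"
proof -
  have "lam i = 0" if "spec_decomp jp u 0 k lam c" "i < k" for k lam c i
  proof -
    have c: "c i \<odot> c i = c i" "c i \<noteq> 0" "\<And>j. j < k \<Longrightarrow> j \<noteq> i \<Longrightarrow> c i \<odot> c j = 0"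
      and s: "(\<Sum>j<k. lam j *\<^sub>R c j) = 0"
      using that unfolding spec_decomp_def idem_def by metis+
    have "c i \<odot> (\<Sum>j<k. lam j *\<^sub>R c j) = (\<Sum>j<k. if j = i then lam i *\<^sub>R c i else 0)"
      unfolding jp_sum_right by (intro sum.cong refl) (use c in \<open>auto simp: jp_linear\<close>)
    then have "lam i *\<^sub>R c i = 0" using s that(2) by simp
    then show ?thesis using c(2) by simp
  qed
  then have "jspectrum jp u 0 \<subseteq> {0}" unfolding jspectrum_def by auto
  moreover have "spec_decomp jp u 0 1 (\<lambda>_. 0) (\<lambda>_. u)"
    using unit_nonzero by (auto simp: spec_decomp_def idem_def inj_on_def)
  then have "0 \<in> jspectrum jp u 0" unfolding jspectrum_def by force
  ultimately have "jspectrum jp u 0 = {0}" by blast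
  then show ?thesis by (simp add: unorm_def)
qed

section \<open>Faces of the cone and the Hilbert distance\<close>

lemma prim_decomp_bound:
  assumes "prim_decomp jp y p"
  shows "p \<odot> p = p" "\<exists>K\<ge>0. y \<preceq> K *\<^sub>R p"
proof -
  obtain n :: nat and q \<alpha> where prim: "\<forall>i<n. primitive_idem jp (q i)"
    and orth: "\<forall>i<n. \<forall>j<n. i \<noteq> j \<longrightarrow> q i \<odot> q j = 0"
    and y: "y = (\<Sum>i<n. exp (- \<alpha> i) *\<^sub>R q i)" and p: "p = (\<Sum>i<n. q i)"
    using assms unfolding prim_decomp_def by blast
  have q: "q i \<odot> q i = q i" "i \<noteq> j \<Longrightarrow> j < n \<Longrightarrow> q i \<odot> q j = 0" if "i < n" for i j
    using prim orth that by (auto simp: primitive_idem_def idem_def)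
  have "p \<odot> p = (\<Sum>i<n. \<Sum>j<n. if j = i then q i else 0)"
    unfolding p jp_sum_left jp_sum_right by (intro sum.cong refl) (use q in auto)
  also have "\<dots> = p" unfolding p by (rule sum.cong) simp_all
  finally show "p \<odot> p = p" .
  \<comment> \<open>The sum bounds every coefficient and, unlike a maximum, also makes sense for the
    empty family.\<close>
  define K where "K = (\<Sum>i<n. exp (- \<alpha> i))"
  have "K *\<^sub>R p - y = (\<Sum>i<n. (K - exp (- \<alpha> i)) *\<^sub>R q i)"
    by (simp add: p y scaleR_sum_right sum_subtractf scaleR_diff_left)
  also have "\<dots> \<in> Apos jp"
  proof (intro Apos_sum Apos_scale)
    fix i assume i: "i \<in> {..<n}"
    show "q i \<in> Apos jp" using q(1) i by (intro Apos_idempotent) simp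
    show "0 \<le> K - exp (- \<alpha> i)"
      using member_le_sum[OF i, of "\<lambda>i. exp (- \<alpha> i)"] by (simp add: K_def)
  qed
  finally have "y \<preceq> K *\<^sub>R p" by (simp add: cle_def)
  moreover have "K \<ge> 0" by (simp add: K_def sum_nonneg)
  ultimately show "\<exists>K\<ge>0. y \<preceq> K *\<^sub>R p" by blast
qed

text \<open>For x = w^2 the trace against \<open>u - p\<close> is zero, so \<open>u - p\<close>
  annihilates \<open>w\<close>. Then \<open>w\<close>, and with it its square, lies in the Peirce
  1-space of \<open>p\<close>.\<close>

lemma U_fixes_face:
  assumes p: "p \<odot> p = p" and x: "x \<in> Apos jp" and le: "x \<preceq> b *\<^sub>R p"
  shows "U p x = x"
proof -
  obtain w where w: "x = w \<odot> w" using x by (auto simp: Apos_def)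
  define q where "q = u - p"
  have q: "q \<odot> q = q" "p \<odot> q = 0" using p by (simp_all add: q_def jp_linear)
  have "tf x q \<ge> 0" "tf (b *\<^sub>R p - x) q \<ge> 0" using x le q(1) by (simp_all add: Apos_iff cle_def)
  moreover have "tf p q = 0" using q(2) by (simp add: tf_def trace_of_def)
  ultimately have "tf x q = 0" by (simp add: tf_linear)
  moreover have "tf x q = tf (q \<odot> w) w"
    unfolding w tf_assoc[of w w q] comm[of w q] by (rule tf_commute)
  ultimately have "q \<odot> w = 0" using tf_idempotent_zero[OF q(1)] by simp
  then have "p \<odot> w = w" by (simp add: q_def jp_linear)
  then have "p \<odot> x = x" using peirce_mult[of p w 1 w 1] p by (simp add: w)
  then show ?thesis by (simp add: Uop_def p scaleR_2)
qed

text \<open>On elements fixed by \<open>U p\<close> the subalgebra and the whole algebra have the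
  same order, so the Hilbert distance can be evaluated with the cone of the whole algebra.\<close>

lemma Ucone_le_iff:
  assumes "U p a = a" "U p b = b"
  shows "cle (Ucone jp p) a (\<beta> *\<^sub>R b) \<longleftrightarrow> a \<preceq> \<beta> *\<^sub>R b"
proof -
  have "U p (\<beta> *\<^sub>R b - a) = \<beta> *\<^sub>R b - a"
    by (simp add: linear_diff[OF linear_U] linear_scale[OF linear_U] assms)
  then have "\<beta> *\<^sub>R b - a \<in> range (U p)" by (metis rangeI)
  then show ?thesis by (simp add: cle_def Ucone_def)
qed

lemma jle_exp_mono: "x \<preceq> exp a *\<^sub>R y \<Longrightarrow> y \<in> Apos jp \<Longrightarrow> a \<le> b \<Longrightarrow> x \<preceq> exp b *\<^sub>R y"
  using jle_trans jle_mono_scalar[of y "exp a" "exp b"] by (meson exp_le_cancel_iff)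

lemma jsim_iff_exp:
  assumes x: "x \<in> Apos jp" and y: "y \<in> Apos jp"
  shows "jsim jp x y \<longleftrightarrow> (\<exists>a. x \<preceq> exp a *\<^sub>R y) \<and> (\<exists>b. y \<preceq> exp b *\<^sub>R x)"
proof
  assume "jsim jp x y"
  then obtain \<alpha> \<beta> where ab: "0 < \<alpha>" "\<alpha> \<le> \<beta>" "\<alpha> *\<^sub>R y \<preceq> x" "x \<preceq> \<beta> *\<^sub>R y"
    unfolding jsim_def by blast
  have "x \<preceq> exp (ln \<beta>) *\<^sub>R y" using ab by simp
  moreover have "(1 / \<alpha>) *\<^sub>R (\<alpha> *\<^sub>R y) \<preceq> (1 / \<alpha>) *\<^sub>R x" using ab by (intro jle_scale) auto
  then have "y \<preceq> exp (ln (1 / \<alpha>)) *\<^sub>R x" using ab by simp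
  ultimately show "(\<exists>a. x \<preceq> exp a *\<^sub>R y) \<and> (\<exists>b. y \<preceq> exp b *\<^sub>R x)" by blast
next
  assume "(\<exists>a. x \<preceq> exp a *\<^sub>R y) \<and> (\<exists>b. y \<preceq> exp b *\<^sub>R x)"
  then obtain a b where ab: "x \<preceq> exp a *\<^sub>R y" "y \<preceq> exp b *\<^sub>R x" by blast
  \<comment> \<open>The 0 ensures \<open>exp (- c) \<le> exp c\<close>, the order of constants that
    \<open>jsim\<close> demands.\<close>
  define c where "c = max 0 (max a b)"
  have c: "0 \<le> c" "a \<le> c" "b \<le> c" by (simp_all add: c_def)
  have "x \<preceq> exp c *\<^sub>R y" using jle_exp_mono[OF ab(1) y c(2)] .
  moreover have "exp (- c) *\<^sub>R y \<preceq> exp (- c) *\<^sub>R (exp c *\<^sub>R x)"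
    using jle_exp_mono[OF ab(2) x c(3)] by (intro jle_scale) auto
  then have "exp (- c) *\<^sub>R y \<preceq> x" by (simp add: exp_minus_inverse exp_add[symmetric])
  moreover have "exp (- c) \<le> exp c" using c by simp
  ultimately show "jsim jp x y" unfolding jsim_def using x y by (meson exp_gt_zero)
qed

text \<open>Its infimum is M((y',z')/(y,z)) on the product; the dominating pair comes first among
  the arguments.\<close>

definition dominating_scalars :: "'a \<Rightarrow> 'a \<Rightarrow> 'a \<Rightarrow> 'a \<Rightarrow> real set" where
  "dominating_scalars y z y' z' = {\<beta>. y' \<preceq> \<beta> *\<^sub>R y \<and> z' \<preceq> \<beta> *\<^sub>R z}"

lemma ln_Inf_dominating:
  assumes y: "y \<in> Apos jp" and z: "z \<in> Apos jp" and y': "y' \<in> Apos jp" and z': "z' \<in> Apos jp"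
    and ne': "y' \<noteq> 0 \<or> z' \<noteq> 0" and ex: "\<exists>a. y' \<preceq> exp a *\<^sub>R y" "\<exists>b. z' \<preceq> exp b *\<^sub>R z"
  shows "ln (Inf (dominating_scalars y z y' z')) \<le> c \<longleftrightarrow> y' \<preceq> exp c *\<^sub>R y \<and> z' \<preceq> exp c *\<^sub>R z"
proof (subst ln_Inf_le_iff)
  obtain a b where ab: "y' \<preceq> exp a *\<^sub>R y" "z' \<preceq> exp b *\<^sub>R z" using ex by blast
  have "exp (max a b) \<in> dominating_scalars y z y' z'"
    using jle_exp_mono[OF ab(1) y, of "max a b"] jle_exp_mono[OF ab(2) z, of "max a b"]
    by (simp add: dominating_scalars_def)
  then show "dominating_scalars y z y' z' \<noteq> {}" by blast
  show "closed (dominating_scalars y z y' z')"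
    unfolding dominating_scalars_def Collect_conj_eq by (intro closed_Int closed_jle)
  show "0 < \<beta>" if "\<beta> \<in> dominating_scalars y z y' z'" for \<beta>
    using that ne' jle_scalar_pos[OF y' _ y] jle_scalar_pos[OF z' _ z] by (auto simp: dominating_scalars_def)
  show "\<gamma> \<in> dominating_scalars y z y' z'" if "\<beta> \<in> dominating_scalars y z y' z'" "\<beta> \<le> \<gamma>" for \<beta> \<gamma>
    using that jle_mono_scalar[OF y that(2)] jle_mono_scalar[OF z that(2)]
    unfolding dominating_scalars_def by (blast intro: jle_trans)
qed (simp_all add: dominating_scalars_def)

text \<open>Equivalent elements vanish together, and a vanishing pair contributes the condition 0 <=
  0, so the product formula also covers an omitted summand. The bound by the support idempotent
  places all vectors in the fixed spaces of \<open>U pI\<close> and \<open>U pJ\<close>.\<close>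

lemma dH_pair_eq:
  assumes y: "y \<in> Apos jp" and z: "z \<in> Apos jp" and y': "y' \<in> Apos jp" and z': "z' \<in> Apos jp"
    and dI: "prim_decomp jp y pI" and dJ: "prim_decomp jp z pJ"
    and sy: "jsim jp y y'" and sz: "jsim jp z z'"
  shows "dH_pair jp pI pJ y z y' z' = ln (Inf (dominating_scalars y z y' z')) + ln (Inf (dominating_scalars y' z' y z))"
proof -
  have face: "U p x = x \<and> U p x' = x'"
    if x: "x \<in> Apos jp" and x': "x' \<in> Apos jp" and d: "prim_decomp jp x p" and s: "jsim jp x x'" for x x' p
  proof -
    obtain K where K: "K \<ge> 0" "x \<preceq> K *\<^sub>R p" using prim_decomp_bound(2)[OF d] by blast
    obtain b where "x' \<preceq> exp b *\<^sub>R x" using s jsim_iff_exp[OF x x'] by blast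
    moreover have "exp b *\<^sub>R x \<preceq> exp b *\<^sub>R (K *\<^sub>R p)" using K by (intro jle_scale) auto
    ultimately have "x' \<preceq> (exp b * K) *\<^sub>R p" using jle_trans by simp
    then show ?thesis using U_fixes_face[OF prim_decomp_bound(1)[OF d]] x x' K by blast
  qed
  have Uy: "U pI y = y" "U pI y' = y'" using face[OF y y' dI sy] by auto
  have Uz: "U pJ z = z" "U pJ z' = z'" using face[OF z z' dJ sz] by auto
  have zero: "x' = 0" if "x \<in> Apos jp" "x' \<in> Apos jp" "jsim jp x x'" "x = 0" for x x'
    using that jsim_iff_exp[of x x'] jle_zero_imp by auto
  consider "y = 0" "y' = 0" | "y \<noteq> 0" "z = 0" "z' = 0" | "y \<noteq> 0" "z \<noteq> 0"
    using zero[OF y y' sy] zero[OF z z' sz] by blast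
  then show ?thesis
  proof cases
    case 1
    then show ?thesis
      by (simp add: dH_pair_def dH_def Mc_def Ucone_le_iff Uz dominating_scalars_def)
  next
    case 2
    then show ?thesis
      by (simp add: dH_pair_def dH_def Mc_def Ucone_le_iff Uy dominating_scalars_def)
  next
    case 3
    have "cle (Ucone jp pI \<times> Ucone jp pJ) (a, b) (\<beta> *\<^sub>R (a', b')) \<longleftrightarrow>
        cle (Ucone jp pI) a (\<beta> *\<^sub>R a') \<and> cle (Ucone jp pJ) b (\<beta> *\<^sub>R b')" for a b a' b' \<beta>
      by (simp add: cle_def)
    with 3 show ?thesis
      by (simp add: dH_pair_def dH_def Mc_def Ucone_le_iff Uy Uz dominating_scalars_def)
  qed
qed

text \<open>The cost and the logarithm of the infimum have the same real upper bounds, hence agree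
  as extended reals; a cost below infinity has some real upper bound, which yields the two
  dominations.\<close>

lemma detour_cost_eq:
  assumes h: "h \<in> closure (hw jp u ` Aint jp)" and h': "h' \<in> closure (hw jp u ` Aint jp)"
    and hdef: "\<forall>x\<in>Aint jp. h x = horo_formula jp u y z x"
    and hdef': "\<forall>x\<in>Aint jp. h' x = horo_formula jp u y' z' x"
    and pos: "y \<in> Apos jp" "z \<in> Apos jp" "y' \<in> Apos jp" "z' \<in> Apos jp"
    and yz: "y \<odot> z = 0" and ne: "y \<noteq> 0 \<or> z \<noteq> 0" and ne': "y' \<noteq> 0 \<or> z' \<noteq> 0"
  shows "detour_cost jp u h h' < \<infinity> \<longleftrightarrow> (\<exists>a. y' \<preceq> exp a *\<^sub>R y) \<and> (\<exists>b. z' \<preceq> exp b *\<^sub>R z)" (is "?fin \<longleftrightarrow> ?ex")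
    and "\<exists>a. y' \<preceq> exp a *\<^sub>R y \<Longrightarrow> \<exists>b. z' \<preceq> exp b *\<^sub>R z \<Longrightarrow>
      detour_cost jp u h h' = ereal (ln (Inf (dominating_scalars y z y' z')))"
proof -
  note le = detour_cost_le_iff[OF h h' hdef hdef' pos yz ne ne']
  have eq: "detour_cost jp u h h' = ereal (ln (Inf (dominating_scalars y z y' z')))" if ?ex
  proof -
    have "ereal (ln (Inf (dominating_scalars y z y' z'))) \<le> ereal c \<longleftrightarrow> detour_cost jp u h h' \<le> ereal c" for c
      using le[of c] ln_Inf_dominating[OF pos ne'] that by simp
    then show ?thesis by (meson antisym ereal_le_real)
  qed
  then show "\<exists>a. y' \<preceq> exp a *\<^sub>R y \<Longrightarrow> \<exists>b. z' \<preceq> exp b *\<^sub>R z \<Longrightarrow>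
      detour_cost jp u h h' = ereal (ln (Inf (dominating_scalars y z y' z')))" by blast
  show "?fin \<longleftrightarrow> ?ex"
  proof
    assume ?fin
    then obtain c where "detour_cost jp u h h' \<le> ereal c"
      by (cases "detour_cost jp u h h'") auto
    then show ?ex using le[of c] by blast
  qed (use eq in simp)
qed

end

theorem theorem3p3:
  fixes jp :: "'a::euclidean_space \<Rightarrow> 'a \<Rightarrow> 'a" and u :: 'a
    and h h' :: "'a \<Rightarrow> real" and y z y' z' pI pJ :: 'a
  assumes A: "formally_real_jordan jp u"
    and hor: "h \<in> horofunctions jp u" and hor': "h' \<in> horofunctions jp u"
    and hdef: "\<forall>x\<in>Aint jp. h x = horo_formula jp u y z x"
    and hdef': "\<forall>x\<in>Aint jp. h' x = horo_formula jp u y' z' x"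
    and pos: "y \<in> Apos jp" "z \<in> Apos jp" "y' \<in> Apos jp" "z' \<in> Apos jp"
    and orth: "jp y z = 0" "jp y' z' = 0"
    and nrm: "max (unorm jp u y) (unorm jp u z) = 1" "max (unorm jp u y') (unorm jp u z') = 1"
    and dI: "prim_decomp jp y pI" and dJ: "prim_decomp jp z pJ"
  shows "(detour_dist jp u h h' < \<infinity> \<longleftrightarrow> jsim jp y y' \<and> jsim jp z z')
    \<and> (jsim jp y y' \<and> jsim jp z z' \<longrightarrow>
         detour_dist jp u h h' = ereal (dH_pair jp pI pJ y z y' z'))"
proof -
  interpret euclidean_jordan jp u by unfold_locales (rule A)
  have cl: "h \<in> closure (hw jp u ` Aint jp)" "h' \<in> closure (hw jp u ` Aint jp)"
    using hor hor' by (auto simp: horofunctions_def)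
  have ne: "y \<noteq> 0 \<or> z \<noteq> 0" "y' \<noteq> 0 \<or> z' \<noteq> 0" using nrm unorm_zero by force+
  note cost = detour_cost_eq[OF cl hdef hdef' pos orth(1) ne]
    and cost' = detour_cost_eq[OF cl(2,1) hdef' hdef pos(3,4,1,2) orth(2) ne(2,1)]
  note sim = jsim_iff_exp[OF pos(1,3)] jsim_iff_exp[OF pos(2,4)]
  have eq: "detour_dist jp u h h' = ereal (dH_pair jp pI pJ y z y' z')"
    if s: "jsim jp y y'" "jsim jp z z'"
    using cost(2) cost'(2) s sim unfolding detour_dist_def dH_pair_eq[OF pos dI dJ s] by simp
  have "jsim jp y y' \<and> jsim jp z z'" if "detour_dist jp u h h' < \<infinity>"
  proof -
    \<comment> \<open>In \<open>ereal\<close> a sum with a summand \<infinity> is \<infinity>,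
      whatever the other summand, so both costs are below it.\<close>
    have "detour_cost jp u h h' < \<infinity>" "detour_cost jp u h' h < \<infinity>"
      using that unfolding detour_dist_def by auto
    then show ?thesis using cost(1) cost'(1) sim by blast
  qed
  then show ?thesis using eq by auto
qed

end
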